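(* Let $n,m,l\in\mathbb{N}$, let $\Phi:\mathbb{M}_n\to\mathbb{M}_l$ and $\Psi:\mathbb{M}_m\to\mathbb{M}_l$ be strictly positive linear maps that are completely positive, let $-1\le p\le0$, and let $f$ be a non-decreasing concave function on $(0,\infty)$ with $\lim_{x\to\infty}f(x)/x=0$ such that $x\mapsto f(x^{2+p})$ is convex on $(0,\infty)$. Then $$(A,B)\in\mathbb{P}_n\times\mathbb{P}_m\longmapsto\mathrm{Tr}\, f\bigl(\Phi(A^p)^{1/2}\Psi(B^2)\Phi(A^p)^{1/2}\bigr)$$ is jointly convex.
   Context: $\mathbb{M}_n$: $n\times n$ complex matrices; $\mathbb{P}_n$: positive definite ones; $\mathrm{Tr}$: usual trace. A linear map is strictly positive if it maps positive definite matrices to positive definite matrices. *)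

theory Defs
  imports "HOL-Analysis.Analysis" "Jordan_Normal_Form.Matrix"
begin

definition adj :: "complex mat \<Rightarrow> complex mat" where
  "adj A = mat (dim_col A) (dim_row A) (\<lambda>(i,j). cnj (A $$ (j,i)))"

definition herm_form :: "complex mat \<Rightarrow> complex vec \<Rightarrow> complex" where
  "herm_form A v = (\<Sum>i<dim_vec v. cnj (v $ i) * (A *\<^sub>v v) $ i)"

definition pos_def :: "nat \<Rightarrow> complex mat \<Rightarrow> bool" where
  "pos_def n A \<longleftrightarrow> A \<in> carrier_mat n n \<and> adj A = A \<and>
     (\<forall>v \<in> carrier_vec n. v \<noteq> 0\<^sub>v n \<longrightarrow> Re (herm_form A v) > 0)"

definition pos_semidef :: "nat \<Rightarrow> complex mat \<Rightarrow> bool" where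
  "pos_semidef n A \<longleftrightarrow> A \<in> carrier_mat n n \<and> adj A = A \<and>
     (\<forall>v \<in> carrier_vec n. Re (herm_form A v) \<ge> 0)"

definition unitary :: "nat \<Rightarrow> complex mat \<Rightarrow> bool" where
  "unitary n U \<longleftrightarrow> U \<in> carrier_mat n n \<and> adj U * U = 1\<^sub>m n"

definition mtrace :: "complex mat \<Rightarrow> complex" where
  "mtrace A = (\<Sum>i<dim_row A. A $$ (i,i))"

text \<open>Functional calculus for Hermitian matrices: if A = U D U* with U unitary and D real
  diagonal, then f(A) = U f(D) U*. (Independent of the chosen decomposition.)\<close>
definition mfun :: "(real \<Rightarrow> real) \<Rightarrow> complex mat \<Rightarrow> complex mat" where
  "mfun f A = (SOME B. \<exists>U D. unitary (dim_row A) U \<and> D \<in> carrier_mat (dim_row A) (dim_row A)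
      \<and> diagonal_mat D \<and> (\<forall>i < dim_row A. D $$ (i,i) \<in> \<real>)
      \<and> A = U * D * adj U
      \<and> B = U * mat (dim_row A) (dim_row A)
              (\<lambda>(i,j). if i = j then complex_of_real (f (Re (D $$ (i,i)))) else 0) * adj U)"

definition mpow :: "complex mat \<Rightarrow> real \<Rightarrow> complex mat" where
  "mpow A p = mfun (\<lambda>x. x powr p) A"

definition lin_map :: "nat \<Rightarrow> nat \<Rightarrow> (complex mat \<Rightarrow> complex mat) \<Rightarrow> bool" where
  "lin_map n l \<Phi> \<longleftrightarrow>
     (\<forall>A \<in> carrier_mat n n. \<Phi> A \<in> carrier_mat l l) \<and>
     (\<forall>A \<in> carrier_mat n n. \<forall>B \<in> carrier_mat n n. \<Phi> (A + B) = \<Phi> A + \<Phi> B) \<and>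
     (\<forall>c. \<forall>A \<in> carrier_mat n n. \<Phi> (c \<cdot>\<^sub>m A) = c \<cdot>\<^sub>m \<Phi> A)"

definition strictly_positive :: "nat \<Rightarrow> nat \<Rightarrow> (complex mat \<Rightarrow> complex mat) \<Rightarrow> bool" where
  "strictly_positive n l \<Phi> \<longleftrightarrow> (\<forall>A. pos_def n A \<longrightarrow> pos_def l (\<Phi> A))"

definition block :: "nat \<Rightarrow> complex mat \<Rightarrow> nat \<Rightarrow> nat \<Rightarrow> complex mat" where
  "block n M a b = mat n n (\<lambda>(r,s). M $$ (a * n + r, b * n + s))"

text \<open>Complete positivity: id_k tensor Phi is positive for all k, i.e. it maps positive
  semidefinite block matrices [A_ab] to positive semidefinite block matrices [Phi(A_ab)].\<close>
definition completely_positive :: "nat \<Rightarrow> nat \<Rightarrow> (complex mat \<Rightarrow> complex mat) \<Rightarrow> bool" where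
  "completely_positive n l \<Phi> \<longleftrightarrow>
     (\<forall>k M. pos_semidef (k * n) M \<longrightarrow>
        pos_semidef (k * l)
          (mat (k * l) (k * l) (\<lambda>(i,j). \<Phi> (block n M (i div l) (j div l)) $$ (i mod l, j mod l))))"

end

theory Submission
  imports Defs "Jordan_Normal_Form.Spectral_Radius"
begin

text \<open>Write \<open>r = -p\<close>, \<open>P = \<Phi>(A\<^sup>p)\<close> and \<open>h(\<tau>) = sup\<^sub>u (f(u) - u/\<tau>)\<close>. Concavity of \<open>f\<close> gives
  \<open>Tr f(P\<^sup>1\<^sup>/\<^sup>2 \<Psi>(B\<^sup>2) P\<^sup>1\<^sup>/\<^sup>2) = inf\<^sub>Z (Tr \<Psi>(B\<^sup>2) Z\<^sup>-\<^sup>1 + Tr h(P\<^sup>1\<^sup>/\<^sup>2 Z P\<^sup>1\<^sup>/\<^sup>2))\<close>, so it suffices that both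
  terms are jointly convex. The first is, since it is a supremum of affine functions once \<open>\<Psi>\<close> is
  written with Kraus operators. For the second, convexity of \<open>f(x\<^sup>2\<^sup>+\<^sup>p)\<close> makes \<open>k(x) = h(x\<^sup>1\<^sup>-\<^sup>r)\<close> convex,
  and with a subgradient \<open>y\<close> of \<open>h\<close> the term is a saddle value of
  \<open>Tr W* Z W - Tr W* P\<^sup>-\<^sup>1 W U\<^sup>1\<^sup>-\<^sup>r + Tr k(U)\<close>, where \<open>W = P\<^sup>1\<^sup>/\<^sup>2 y(P\<^sup>1\<^sup>/\<^sup>2 Z P\<^sup>1\<^sup>/\<^sup>2)\<^sup>1\<^sup>/\<^sup>2\<close>; the middle trace is
  jointly concave in \<open>(A, U)\<close> by Lieb's theorem, which is proved from the representation of
  \<open>a\<^sup>r u\<^sup>1\<^sup>-\<^sup>r\<close> as an integral of parallel sums.\<close>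

section \<open>Scalar inequalities\<close>

text \<open>The variational formula separates the two maps: in the original trace \<open>A\<close>
  and \<open>B\<close> share one noncommuting product, whereas with T = P^(1/2) Z P^(1/2) the trace
  of P^(1/2) \<Psi>(B^2) P^(1/2) T^(-1) loses \<open>A\<close>, and Tr h(T) does not contain
  \<open>B\<close>. An infimum over Z of a function jointly convex in (A, B, Z) is jointly convex in
  (A, B). Lieb's theorem asks for two exponents with sum 1; since P^(-1) behaves like A^r, this
  dictates the power U^(1-r) and with it the substitution behind k. Three degeneracies shape the
  details. A supergradient of \<open>f\<close> may be 0, so the infimum need not be attained and is
  approached up to \<epsilon>. A slope y may be 0 where k is flat, and then W is singular and its
  polar decomposition breaks down; adding \<delta> u to k keeps y positive, and \<delta> tends to 0
  at the end. At p = -1 the exponent 1/(1-r) is lost, but there \<open>f\<close> is itself convex,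
  and growing slower than linearly it must be constant.\<close>

lemma convex_on_subgradient:
  fixes f :: "real \<Rightarrow> real"
  assumes "convex_on {0<..} f" "0 < x"
  obtains d where "\<And>y. 0 < y \<Longrightarrow> f x + d * (y - x) \<le> f y"
  using convex_le_Inf_differential[OF assms(1), of x] assms(2)
  by (auto simp: interior_open)

lemma subgradient_nonneg:
  fixes f :: "real \<Rightarrow> real"
  assumes "mono_on {0<..} f" "0 < x" and d: "\<And>y. 0 < y \<Longrightarrow> f x + d * (y - x) \<le> f y"
  shows "0 \<le> d"
proof -
  have "f (x/2) \<le> f x" using assms(1,2) by (auto simp: mono_on_def)
  moreover have "f x + d * (x/2 - x) \<le> f (x/2)" using d[of "x/2"] assms(2) by simp
  ultimately have "0 \<le> d * x" by (simp add: field_simps)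
  thus ?thesis using assms(2) by (simp add: zero_le_mult_iff)
qed

lemma supergradient_nonneg:
  fixes f :: "real \<Rightarrow> real"
  assumes "mono_on {0<..} f" "concave_on {0<..} f" "0 < x"
  obtains d where "0 \<le> d" "\<And>y. 0 < y \<Longrightarrow> f y \<le> f x + d * (y - x)"
proof -
  have "convex_on {0<..} (\<lambda>x. - f x)" using assms(2) by (simp add: concave_on_def)
  then obtain d where d: "\<And>y. 0 < y \<Longrightarrow> - f x + d * (y - x) \<le> - f y"
    using convex_on_subgradient assms(3) by meson
  have 1: "f y \<le> f x + (-d) * (y - x)" if "0 < y" for y
    using d[OF that] by simp
  have "f x \<le> f (2 * x)" using assms(1,3) by (auto simp: mono_on_def)
  moreover have "f (2*x) \<le> f x + (-d) * (2 * x - x)" using 1[of "2*x"] assms(3) by simp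
  ultimately have "0 \<le> (-d) * x" by simp
  hence "0 \<le> -d" using assms(3) by (metis mult_le_0_iff neg_0_le_iff_le mult_minus_left not_less)
  thus ?thesis using 1 that by blast
qed

text \<open>This settles the endpoint \<open>p = -1\<close>. A subgradient at \<open>b\<close> gives
  a line below \<open>f\<close>, and sublinear growth forces its slope to be at most 0, so
  \<open>f\<close> is non-increasing as well as non-decreasing.\<close>

lemma convex_sublinear_mono_const:
  fixes f :: "real \<Rightarrow> real"
  assumes "mono_on {0<..} f" "convex_on {0<..} f" "((\<lambda>x. f x / x) \<longlongrightarrow> 0) at_top" "0 < x"
  shows "f x = f 1"
proof -
  have le: "f b \<le> f a" if "0 < a" "a \<le> b" for a b
  proof -
    have b: "0 < b" using that by simp
    obtain d where d: "\<And>y. 0 < y \<Longrightarrow> f b + d * (y - b) \<le> f y"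
      using convex_on_subgradient[OF assms(2) b] by meson
    have "d \<le> 0"
    proof (rule tendsto_le[OF _ assms(3)])
      show "((\<lambda>y. (f b - d * b) / y + d) \<longlongrightarrow> d) at_top"
        by (rule tendsto_eq_intros tendsto_divide_0[OF tendsto_const] filterlim_at_top_imp_at_infinity filterlim_ident | simp)+
      show "\<forall>\<^sub>F y in at_top. (f b - d * b) / y + d \<le> f y / y"
        using eventually_gt_at_top[of 0]
      proof eventually_elim
        case (elim y)
        have "((f b - d * b) / y + d) * y = f b - d * b + d * y" using elim by (simp add: distrib_right)
        hence "((f b - d * b) / y + d) * y \<le> f y" using d[OF elim] by (simp add: algebra_simps)
        thus ?case using elim by (simp add: pos_le_divide_eq)
      qed
    qed simp
    hence "0 \<le> d * (a - b)" using that by (simp add: mult_nonpos_nonpos)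
    thus ?thesis using d[OF that(1)] by linarith
  qed
  have ge: "f a \<le> f b" if "0 < a" "a \<le> b" for a b
    using assms(1) that by (auto simp: mono_on_def)
  show ?thesis using le[of x 1] le[of 1 x] ge[of x 1] ge[of 1 x] assms(4) by (cases "x \<le> 1") auto
qed

text \<open>The conjugate of \<open>f\<close> at slope \<open>1/\<tau>\<close>; junk where the supremum is infinite.\<close>

definition legendre :: "(real \<Rightarrow> real) \<Rightarrow> real \<Rightarrow> real" where
  "legendre f \<tau> = (SUP u\<in>{0<..}. f u - u / \<tau>)"

text \<open>Far out \<open>f\<close> lies below the line of slope 1/\<tau>, so the difference is
  negative there; up to that point monotonicity bounds it by \<open>f N\<close>.\<close>

lemma legendre_bdd:
  fixes f :: "real \<Rightarrow> real"
  assumes "mono_on {0<..} f" "((\<lambda>x. f x / x) \<longlongrightarrow> 0) at_top" "0 < \<tau>"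
  shows "bdd_above ((\<lambda>u. f u - u / \<tau>) ` {0<..})"
proof -
  have "\<forall>\<^sub>F x in at_top. f x / x < 1 / \<tau>"
    using order_tendstoD(2)[OF assms(2)] assms(3) by simp
  hence "\<forall>\<^sub>F x in at_top. f x / x < 1 / \<tau> \<and> 0 < x"
    using eventually_gt_at_top[of "0::real"] by (rule eventually_conj)
  then obtain N where N: "\<And>x. N \<le> x \<Longrightarrow> f x / x < 1 / \<tau> \<and> 0 < x"
    by (auto simp: eventually_at_top_linorder)
  have N0: "0 < N" using N[of N] by simp
  show ?thesis
  proof (rule bdd_aboveI2[where M = "max 0 (f N)"])
    fix u :: real assume "u \<in> {0<..}"
    hence u: "0 < u" by simp
    show "f u - u / \<tau> \<le> max 0 (f N)"
    proof (cases "N \<le> u")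
      case True
      hence "f u < u / \<tau>" using N[OF True] by (auto simp: pos_divide_less_eq)
      thus ?thesis by simp
    next
      case False
      hence "f u \<le> f N" using assms(1) u by (auto simp: mono_on_def)
      moreover have "0 \<le> u / \<tau>" using u assms(3) by simp
      ultimately show ?thesis by linarith
    qed
  qed
qed

context
  fixes f :: "real \<Rightarrow> real"
  assumes mono: "mono_on {0<..} f" and lim: "((\<lambda>x. f x / x) \<longlongrightarrow> 0) at_top"
begin

lemma legendre_upper: "0 < u \<Longrightarrow> 0 < \<tau> \<Longrightarrow> f u - u / \<tau> \<le> legendre f \<tau>"
  unfolding legendre_def by (rule cSUP_upper[OF _ legendre_bdd[OF mono lim]]) auto

lemma legendre_least: "(\<And>u. 0 < u \<Longrightarrow> f u - u / \<tau> \<le> c) \<Longrightarrow> legendre f \<tau> \<le> c"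
  unfolding legendre_def by (rule cSUP_least) auto

lemma legendre_mono: "mono_on {0<..} (legendre f)"
proof (rule mono_onI)
  fix a b :: real assume a: "a \<in> {0<..}" "b \<in> {0<..}" "a \<le> b"
  show "legendre f a \<le> legendre f b"
  proof (rule legendre_least)
    fix u :: real assume u: "0 < u"
    have "u / b \<le> u / a" using a u by (intro divide_left_mono) auto
    thus "f u - u / a \<le> legendre f b" using legendre_upper[OF u, of b] a by simp
  qed
qed

text \<open>Biduality for a concave function: the best slope 1/\<tau> at \<open>x\<close> is a
  supergradient of \<open>f\<close> at \<open>x\<close>.\<close>

lemma legendre_attained:
  assumes "concave_on {0<..} f" "0 < x" "0 < \<epsilon>"
  shows "\<exists>\<tau>>0. x / \<tau> + legendre f \<tau> \<le> f x + \<epsilon>"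
proof -
  obtain d where d: "0 \<le> d" "\<And>y. 0 < y \<Longrightarrow> f y \<le> f x + d * (y - x)"
    by (rule supergradient_nonneg[OF mono assms(1,2)]) blast
  \<comment> \<open>The slope \<open>d\<close> may be 0, which no finite \<tau> represents. The
    surplus \<epsilon>/x makes it positive and costs exactly \<epsilon> at \<open>x\<close>.\<close>
  define \<eta> where "\<eta> = d + \<epsilon> / x"
  have e: "0 < \<epsilon> / x" using assms by simp
  have eta: "0 < \<eta>" using d(1) e by (simp add: \<eta>_def)
  have "legendre f (1 / \<eta>) \<le> f x - d * x"
  proof (rule legendre_least)
    fix u :: real assume u: "0 < u"
    have "0 \<le> u * (\<epsilon> / x)" using mult_pos_pos[OF u e] by simp
    thus "f u - u / (1 / \<eta>) \<le> f x - d * x" using d(2)[OF u] by (simp add: \<eta>_def algebra_simps)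
  qed
  moreover have "x / (1 / \<eta>) = d * x + \<epsilon>" using assms by (simp add: \<eta>_def field_simps)
  ultimately show ?thesis using eta by (intro exI[of _ "1 / \<eta>"]) simp
qed

text \<open>The substitution \<open>u = (x w) powr (2 - r)\<close> turns \<open>legendre f (x powr (1 - r))\<close> into a supremum
  over \<open>w\<close> of functions that are convex in \<open>x\<close>.\<close>

lemma legendre_powr_convex:
  assumes conv: "convex_on {0<..} (\<lambda>x. f (x powr (2 - r)))" and r: "r < 1"
  shows "convex_on {0<..} (\<lambda>x. legendre f (x powr (1 - r)))"
proof (rule convex_onI)
  have sub: "f ((x * w) powr (2 - r)) - x * w powr (2 - r) \<le> legendre f (x powr (1 - r))"
    if "0 < x" "0 < w" for x w
  proof -
    have "(x * w) powr (2 - r) / x powr (1 - r) = x powr (2 - r) / x powr (1 - r) * w powr (2 - r)"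
      using that by (simp add: powr_mult)
    also have "x powr (2 - r) / x powr (1 - r) = x"
      using that by (simp flip: powr_diff)
    finally show ?thesis
      using legendre_upper[of "(x * w) powr (2 - r)" "x powr (1 - r)"] that by simp
  qed
  fix t x y :: real assume t: "0 < t" "t < 1" and "x \<in> {0<..}" "y \<in> {0<..}"
  hence x: "0 < x" and y: "0 < y" by auto
  define z where "z = (1 - t) * x + t * y"
  have z: "0 < z" using t x y by (simp add: z_def add_pos_pos)
  have "legendre f (z powr (1 - r)) \<le> (1 - t) * legendre f (x powr (1 - r)) + t * legendre f (y powr (1 - r))"
  proof (rule legendre_least)
    fix u :: real assume u: "0 < u"
    \<comment> \<open>With this \<open>w\<close> the point \<open>u\<close> is the power of
      \<open>z * w\<close>, and the penalty becomes z times a constant. The same \<open>w\<close> is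
      then used at \<open>x\<close> and \<open>y\<close>.\<close>
    define w where "w = u powr (1 / (2 - r)) / z"
    have w: "0 < w" using u z by (simp add: w_def)
    have q: "2 - r \<noteq> 0" using r by simp
    have zw: "u = (z * w) powr (2 - r)" using u z q by (simp add: w_def powr_powr)
    have "u / z powr (1 - r) = z powr (2 - r) / z powr (1 - r) * w powr (2 - r)"
      using z w by (simp add: zw powr_mult)
    also have "z powr (2 - r) / z powr (1 - r) = z"
      using z by (simp flip: powr_diff)
    finally have 1: "f u - u / z powr (1 - r) = f ((z * w) powr (2 - r)) - z * w powr (2 - r)"
      using zw by simp
    have "f ((z * w) powr (2 - r)) \<le> (1 - t) * f ((x * w) powr (2 - r)) + t * f ((y * w) powr (2 - r))"
      using convex_onD[OF conv, of t "x * w" "y * w"] t x y w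
      by (simp add: z_def algebra_simps)
    moreover have "(1 - t) * (f ((x * w) powr (2 - r)) - x * w powr (2 - r)) \<le> (1 - t) * legendre f (x powr (1 - r))"
      "t * (f ((y * w) powr (2 - r)) - y * w powr (2 - r)) \<le> t * legendre f (y powr (1 - r))"
      using sub[OF x w] sub[OF y w] t by (auto intro!: mult_left_mono)
    moreover have "z * w powr (2 - r) = (1 - t) * (x * w powr (2 - r)) + t * (y * w powr (2 - r))"
      by (simp add: z_def algebra_simps)
    ultimately show "f u - u / z powr (1 - r) \<le> (1 - t) * legendre f (x powr (1 - r)) + t * legendre f (y powr (1 - r))"
      unfolding 1 by (simp add: algebra_simps)
  qed
  thus "legendre f (((1 - t) *\<^sub>R x + t *\<^sub>R y) powr (1 - r))
      \<le> (1 - t) * legendre f (x powr (1 - r)) + t * legendre f (y powr (1 - r))"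
    by (simp add: z_def)
qed (simp add: convex_real_interval)

end

text \<open>A tangent of \<open>k\<close> is affine in \<open>u\<close>, but the trace it will meet
  contains \<open>u powr (1 - r)\<close>. Young's inequality, which is the tangent line of this
  concave power at \<tau> powr (1/(1-r)), converts one into the other. The conversion preserves the
  inequality because the slope is nonnegative, and \<delta> makes it strictly positive.\<close>

lemma powr_subgradient:
  fixes k :: "real \<Rightarrow> real"
  assumes "convex_on {0<..} k" "mono_on {0<..} k" "0 < \<delta>" "0 \<le> r" "r < 1" "0 < \<tau>"
  shows "\<exists>y>0. \<forall>u>0. k (\<tau> powr (1 / (1 - r))) + \<delta> * \<tau> powr (1 / (1 - r)) + y * (u powr (1 - r) - \<tau>)
     \<le> k u + \<delta> * u"
proof -
  define s where "s = 1 / (1 - r)"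
  have s: "1 \<le> s" using assms by (simp add: s_def)
  have s1: "1 - r = 1 / s" using assms by (simp add: s_def)
  define \<sigma> where "\<sigma> = \<tau> powr s"
  have sig: "0 < \<sigma>" using assms by (simp add: \<sigma>_def)
  obtain c where c: "\<And>u. 0 < u \<Longrightarrow> k \<sigma> + c * (u - \<sigma>) \<le> k u"
    using convex_on_subgradient[OF assms(1) sig] by meson
  have c0: "0 \<le> c" by (rule subgradient_nonneg[OF assms(2) sig c])
  \<comment> \<open>The chain rule derivative of k(\<tau> powr s) + \<delta> \<tau> powr s, with the
    subgradient \<open>c\<close> in place of the derivative of \<open>k\<close>.\<close>
  define y where "y = (c + \<delta>) * (s * \<tau> powr (s - 1))"
  have "0 < y" using c0 assms s by (simp add: y_def)
  moreover have "k \<sigma> + \<delta> * \<sigma> + y * (u powr (1 - r) - \<tau>) \<le> k u + \<delta> * u" if u: "0 < u" for u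
  proof -
    have "u powr (1/s) * \<sigma> powr (1 - 1/s) \<le> (1/s) * u + (1 - 1/s) * \<sigma>"
      by (rule Youngs_inequality_0) (use u sig s in auto)
    moreover have "\<sigma> powr (1 - 1/s) = \<tau> powr (s - 1)"
      using s by (simp add: \<sigma>_def powr_powr right_diff_distrib)
    ultimately have "s * (u powr (1/s) * \<tau> powr (s - 1)) \<le> s * ((1/s) * u + (1 - 1/s) * \<sigma>)"
      using s by (intro mult_left_mono) auto
    also have "\<dots> = u + (s - 1) * \<sigma>" using s by (simp add: field_simps)
    finally have "s * \<tau> powr (s - 1) * u powr (1/s) - s * \<sigma> \<le> u - \<sigma>" by (simp add: algebra_simps)
    moreover have "\<tau> powr (s - 1) * \<tau> = \<sigma>"
      using assms(6) powr_add[of \<tau> "s - 1" 1] by (simp add: \<sigma>_def)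
    ultimately have "s * \<tau> powr (s - 1) * (u powr (1/s) - \<tau>) \<le> u - \<sigma>"
      by (simp add: right_diff_distrib mult.assoc)
    hence "(c + \<delta>) * (s * \<tau> powr (s - 1) * (u powr (1/s) - \<tau>)) \<le> (c + \<delta>) * (u - \<sigma>)"
      using c0 assms by (intro mult_left_mono) auto
    hence "y * (u powr (1 - r) - \<tau>) \<le> (c + \<delta>) * (u - \<sigma>)"
      by (simp add: y_def s1 mult.assoc)
    thus ?thesis using c[OF u] by (simp add: algebra_simps)
  qed
  ultimately show ?thesis unfolding \<sigma>_def s_def by blast
qed

text \<open>Up to the constant, the weighted geometric mean is an average of parallel sums; the integral
  is scale invariant because \<open>a\<close> and \<open>u\<close> only translate the variable of integration.\<close>

lemma powr_mean_integral:
  assumes r: "0 < r" "r < (1::real)"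
  obtains C where "0 < C" "\<And>a u. 0 < a \<Longrightarrow> 0 < u \<Longrightarrow>
    has_bochner_integral lborel (\<lambda>x. exp (-r * x) * (exp x * a * u / (exp x * a + u))) (C * (a powr r * u powr (1 - r)))"
proof -
  \<comment> \<open>The integrand at a = u = 1. It is bounded by exp(-r x) on the right and by
    exp((1-r) x) on the left, so each strict bound on \<open>r\<close> makes one tail
    integrable.\<close>
  define g where "g x = exp (-r * x) * (exp x / (exp x + 1))" for x :: real
  have g0: "0 < g x" for x unfolding g_def by (simp add: add_pos_pos)
  have gm: "g \<in> borel_measurable borel" unfolding g_def by measurable
  have b1: "g x \<le> exp (- r * x)" for x
    unfolding g_def by (rule mult_left_le) (auto simp: divide_le_eq add_pos_pos)
  have b2: "g x \<le> exp ((1 - r) * x)" for x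
  proof -
    have "exp x / (exp x + 1) \<le> exp x" by (simp add: divide_le_eq add_pos_pos distrib_left)
    hence "g x \<le> exp (-r * x) * exp x" unfolding g_def by (intro mult_left_mono) auto
    thus ?thesis by (simp add: exp_add[symmetric] algebra_simps)
  qed
  have half: "integrable lborel (\<lambda>x. indicator {0..} x * exp (- c * x))" if "0 < c" for c :: real
  proof -
    have "(\<lambda>x. exp (- c * x)) absolutely_integrable_on {0..}"
      by (intro nonnegative_absolutely_integrable_1 integrable_on_exp_minus_to_infinity that) auto
    hence "integrable lebesgue (\<lambda>x. indicator {0..} x * exp (- c * x))"
      by (simp add: set_integrable_def)
    thus ?thesis by (subst (asm) integrable_completion) auto
  qed
  have i1: "integrable lborel (\<lambda>x. indicator {0..} x * exp (- r * x))" by (rule half) fact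
  have "integrable lborel (\<lambda>x. indicator {0..} (0 + (-1) * x) * exp (- (1 - r) * (0 + (-1) * x)))"
    by (rule lborel_integrable_real_affine[OF half]) (use r in auto)
  moreover have "- (1 - r) * (0 + (-1) * x) = (1 - r) * x" for x by (simp add: algebra_simps)
  ultimately have i2: "integrable lborel (\<lambda>x. indicator {0..} (- x) * exp ((1 - r) * x))" by (simp only:) simp
  have ig: "integrable lborel g"
  proof (rule Bochner_Integration.integrable_bound[OF Bochner_Integration.integrable_add[OF i1 i2]])
    show "AE x in lborel. norm (g x) \<le> norm (indicator {0..} x * exp (- r * x) + indicator {0..} (- x) * exp ((1 - r) * x))"
    proof (rule AE_I2)
      fix x :: real
      have "g x \<le> indicator {0..} x * exp (- r * x) + indicator {0..} (- x) * exp ((1 - r) * x)"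
      proof (cases "0 \<le> x")
        case True
        have "(0::real) \<le> indicator {0..} (- x) * exp ((1 - r) * x)" by simp
        moreover have "indicator {0..} x * exp (- r * x) = exp (- r * x)" using True by simp
        ultimately show ?thesis using b1[of x] by linarith
      next
        case False
        thus ?thesis using b2[of x] by simp
      qed
      thus "norm (g x) \<le> norm (indicator {0..} x * exp (- r * x) + indicator {0..} (- x) * exp ((1 - r) * x))"
        using g0[of x] by simp
    qed
  qed (use gm in simp)
  define C where "C = integral\<^sup>L lborel g"
  have hb: "has_bochner_integral lborel g C"
    using ig by (simp add: C_def has_bochner_integral_integrable)
  have "C \<noteq> 0"
  proof
    assume "C = 0"
    hence "AE x in lborel. g x = 0"
      using integral_nonneg_eq_0_iff_AE[OF ig] g0 by (auto simp: C_def less_imp_le)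
    moreover have "g x \<noteq> 0" for x using g0[of x] by simp
    ultimately have "AE x in lborel :: real measure. False" by simp
    hence "emeasure lborel (space lborel :: real set) = 0"
      by (simp only: eventually_False ae_filter_eq_bot_iff)
    thus False by simp
  qed
  moreover have "0 \<le> C" unfolding C_def by (rule integral_nonneg_AE) (use g0 in \<open>auto simp: less_imp_le\<close>)
  ultimately have "0 < C" by simp
  moreover have "has_bochner_integral lborel (\<lambda>x. exp (-r * x) * (exp x * a * u / (exp x * a + u)))
      (C * (a powr r * u powr (1 - r)))" if a: "0 < a" and u: "0 < u" for a u
  proof -
    \<comment> \<open>Translation by ln(a/u) turns exp x / (exp x + 1) into exp x a / (exp x a + u);
      the factor exp(-r c) that it produces reduces a^r u^(1-r) to \<open>u\<close>.\<close>
    define c where "c = ln a - ln u"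
    have ec: "exp c = a / u" using a u by (simp add: c_def exp_diff)
    have "has_bochner_integral lborel (\<lambda>x. g (c + 1 * x)) (C /\<^sub>R \<bar>1\<bar>)"
      using hb by (subst (asm) lborel_has_bochner_integral_real_affine_iff[where c=1 and t=c]) auto
    hence "has_bochner_integral lborel (\<lambda>x. g (c + x) * (a powr r * u powr (1 - r))) (C * (a powr r * u powr (1 - r)))"
      by (intro has_bochner_integral_mult_left) simp
    moreover have "g (c + x) * (a powr r * u powr (1 - r)) = exp (-r * x) * (exp x * a * u / (exp x * a + u))" for x
    proof -
      have "exp (-r * (c + x)) * (a powr r * u powr (1 - r)) = exp (-r * x) * u"
      proof -
        have "a powr r * u powr (1 - r) = exp (r * ln a + (1 - r) * ln u)"
          using a u by (simp add: powr_def exp_add)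
        also have "exp (-r * (c + x)) * \<dots> = exp (-r * x + ln u)"
          by (simp add: c_def exp_add[symmetric] algebra_simps)
        finally show ?thesis using u by (simp only: exp_add exp_ln)
      qed
      moreover have "exp (c + x) / (exp (c + x) + 1) = exp x * a / (exp x * a + u)"
        using u a by (simp add: exp_add ec divide_simps add_pos_pos) (simp add: mult.commute)
      ultimately show ?thesis unfolding g_def by (simp add: field_simps)
    qed
    ultimately show ?thesis by simp
  qed
  ultimately show ?thesis by (rule that)
qed

section \<open>Matrices and the spectral theorem\<close>

lemma adj_dim [simp]: "dim_row (adj A) = dim_col A" "dim_col (adj A) = dim_row A"
  by (simp_all add: adj_def)

lemma adj_carrier [simp]: "A \<in> carrier_mat n m \<Longrightarrow> adj A \<in> carrier_mat m n"
  by (metis adj_dim carrier_matD carrier_matI)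

lemma adj_index [simp]: "i < dim_col A \<Longrightarrow> j < dim_row A \<Longrightarrow> adj A $$ (i,j) = cnj (A $$ (j,i))"
  by (simp add: adj_def)

lemma adj_adj [simp]: "adj (adj A) = A"
  by (rule eq_matI) auto

lemma mult_idx:
  assumes "dim_col A = dim_row B" "i < dim_row A" "j < dim_col B"
  shows "(A * B) $$ (i,j) = (\<Sum>k<dim_row B. A $$ (i,k) * B $$ (k,j))"
  using assms by (simp add: scalar_prod_def lessThan_atLeast0)

text \<open>Side conditions are equations between dimensions instead of carrier memberships, so that
  simp discharges them from a list of dimension facts. The ring laws below have the same
  form.\<close>

lemma assoc_dim:
  "dim_col A = dim_row B \<Longrightarrow> dim_col B = dim_row C \<Longrightarrow> A * B * C = A * (B * C)"
  by (rule assoc_mult_mat[of _ "dim_row A" "dim_col A" _ "dim_col B" _ "dim_col C"]) auto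

lemma adj_mult: "dim_col A = dim_row B \<Longrightarrow> adj (A * B) = adj B * adj A"
  by (rule eq_matI) (auto simp: scalar_prod_def mult.commute)

lemma adj_add: "dim_row A = dim_row B \<Longrightarrow> dim_col A = dim_col B \<Longrightarrow> adj (A + B) = adj A + adj B"
  by (rule eq_matI) auto

lemma adj_smult: "adj (c \<cdot>\<^sub>m A) = cnj c \<cdot>\<^sub>m adj A"
  by (rule eq_matI) auto

lemma adj_one [simp]: "adj (1\<^sub>m n) = 1\<^sub>m n"
  by (rule eq_matI) auto

lemma mult_one_dim:
  fixes A :: "complex mat"
  shows "dim_row A = n \<Longrightarrow> 1\<^sub>m n * A = A" "dim_col A = n \<Longrightarrow> A * 1\<^sub>m n = A"
  using left_mult_one_mat[of A n "dim_col A"] right_mult_one_mat[of A "dim_row A" n]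
  by (auto intro: carrier_matI)

text \<open>\<open>assoc_dim\<close> nests products to the right, which leaves an inverse pair at
  the head of a longer product; this is the cancellation rule for that shape.\<close>

lemma mult_cancel_dim: fixes C :: "complex mat"
  assumes "A * B = 1\<^sub>m n" "dim_col A = dim_row B" "dim_col B = dim_row C"
  shows "A * (B * C) = C"
proof -
  have "dim_col (A * B) = n" using assms(1) by simp
  hence "dim_row C = n" using assms(3) by simp
  moreover have "A * (B * C) = A * B * C" by (rule assoc_dim[symmetric]) (use assms in auto)
  ultimately show ?thesis using assms(1) by (simp add: mult_one_dim)
qed

lemma add_mult_dim:
  "dim_row A = dim_row B \<Longrightarrow> dim_col A = dim_col B \<Longrightarrow> dim_col A = dim_row C \<Longrightarrow> (A + B) * C = A * C + B * C"
  by (rule add_mult_distrib_mat[of _ "dim_row A" "dim_col A" _ _ "dim_col C"]) (auto intro: carrier_matI)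

lemma mult_add_dim:
  "dim_row B = dim_row C \<Longrightarrow> dim_col B = dim_col C \<Longrightarrow> dim_col A = dim_row C \<Longrightarrow> A * (B + C) = A * B + A * C"
  by (rule mult_add_distrib_mat[of _ "dim_row A" "dim_col A" _ "dim_col C"]) (auto intro: carrier_matI)

lemma minus_mult_dim:
  fixes A :: "complex mat"
  shows "dim_row A = dim_row B \<Longrightarrow> dim_col A = dim_col B \<Longrightarrow> dim_col A = dim_row C \<Longrightarrow> (A - B) * C = A * C - B * C"
  by (rule minus_mult_distrib_mat[of _ "dim_row A" "dim_col A" _ _ "dim_col C"]) (auto intro: carrier_matI)

lemma mult_minus_dim:
  fixes A :: "complex mat"
  shows "dim_row B = dim_row C \<Longrightarrow> dim_col B = dim_col C \<Longrightarrow> dim_col A = dim_row C \<Longrightarrow> A * (B - C) = A * B - A * C"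
  by (rule mult_minus_distrib_mat[of _ "dim_row A" "dim_col A" _ "dim_col C"]) (auto intro: carrier_matI)

lemma smult_mult_dim:
  fixes A B :: "complex mat"
  assumes "dim_col A = dim_row B"
  shows "(c \<cdot>\<^sub>m A) * B = c \<cdot>\<^sub>m (A * B)" "A * (c \<cdot>\<^sub>m B) = c \<cdot>\<^sub>m (A * B)"
  by (rule mult_smult_assoc_mat[OF carrier_matI[OF refl refl] carrier_matI[OF assms[symmetric] refl]],
      rule mult_smult_distrib[OF carrier_matI[OF refl refl] carrier_matI[OF assms[symmetric] refl]])

lemma mtrace_mult_comm:
  assumes "dim_col A = dim_row B" "dim_col B = dim_row A"
  shows "mtrace (A * B) = mtrace (B * A)"
proof -
  have "mtrace (A * B) = (\<Sum>i<dim_row A. \<Sum>k<dim_row B. A $$ (i,k) * B $$ (k,i))"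
    using assms by (simp add: mtrace_def mult_idx del: index_mult_mat(1))
  also have "\<dots> = (\<Sum>k<dim_row B. \<Sum>i<dim_row A. B $$ (k,i) * A $$ (i,k))"
    by (subst sum.swap) (simp add: mult.commute)
  also have "\<dots> = mtrace (B * A)"
    using assms by (simp add: mtrace_def mult_idx del: index_mult_mat(1))
  finally show ?thesis .
qed

lemma mtrace_add: "dim_row A = dim_row B \<Longrightarrow> dim_col B = dim_row B \<Longrightarrow> mtrace (A + B) = mtrace A + mtrace B"
  by (simp add: mtrace_def sum.distrib)

lemma mtrace_minus: "dim_row A = dim_row B \<Longrightarrow> dim_col B = dim_row B \<Longrightarrow> mtrace (A - B) = mtrace A - mtrace B"
  by (simp add: mtrace_def sum_subtractf)

lemma mtrace_smult: "dim_col A = dim_row A \<Longrightarrow> mtrace (c \<cdot>\<^sub>m A) = c * mtrace A"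
  by (simp add: mtrace_def sum_distrib_left)

lemma mtrace_adj: "dim_col A = dim_row A \<Longrightarrow> mtrace (adj A) = cnj (mtrace A)"
  by (simp add: mtrace_def)

section \<open>Unitary matrices and real diagonal matrices\<close>

lemma unitary_dim: "unitary n U \<Longrightarrow> dim_row U = n" "unitary n U \<Longrightarrow> dim_col U = n"
  by (auto simp: unitary_def)

lemma unitary_left: "unitary n U \<Longrightarrow> adj U * U = 1\<^sub>m n"
  by (simp add: unitary_def)

lemma unitary_right: "unitary n U \<Longrightarrow> U * adj U = 1\<^sub>m n"
  unfolding unitary_def by (rule mat_mult_left_right_inverse[of "adj U" n U]) simp_all

lemma unitary_mult:
  assumes "unitary n U" "unitary n V"
  shows "unitary n (U * V)"
proof -
  note d = unitary_dim[OF assms(1)] unitary_dim[OF assms(2)]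
  have "adj (U * V) * (U * V) = adj V * (adj U * (U * V))" by (simp add: adj_mult assoc_dim d)
  also have "adj U * (U * V) = V" by (rule mult_cancel_dim[OF unitary_left[OF assms(1)]]) (simp_all add: d)
  finally have "adj (U * V) * (U * V) = 1\<^sub>m n" using unitary_left[OF assms(2)] by simp
  moreover have "U * V \<in> carrier_mat n n" by (rule carrier_matI) (simp_all add: d)
  ultimately show ?thesis by (simp add: unitary_def)
qed

lemma unitary_adj: "unitary n U \<Longrightarrow> unitary n (adj U)"
  using unitary_right[of n U] by (simp add: unitary_def)

lemma unitary_one: "unitary n (1\<^sub>m n)"
  by (simp add: unitary_def)

definition dg :: "nat \<Rightarrow> (nat \<Rightarrow> real) \<Rightarrow> complex mat" where
  "dg n d = mat n n (\<lambda>(i,j). if i = j then complex_of_real (d i) else 0)"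

lemma dg_dim [simp]: "dim_row (dg n d) = n" "dim_col (dg n d) = n"
  by (simp_all add: dg_def)

lemma adj_dg [simp]: "adj (dg n d) = dg n d"
  by (rule eq_matI) (auto simp: dg_def)

lemma dg_cong: "(\<And>i. i < n \<Longrightarrow> d i = e i) \<Longrightarrow> dg n d = dg n e"
  by (rule eq_matI) (auto simp: dg_def)

lemma dg_one: "dg n (\<lambda>_. 1) = 1\<^sub>m n"
  by (rule eq_matI) (auto simp: dg_def)

lemma mult_dg_idx:
  assumes "i < dim_row A" "j < n" "dim_col A = n"
  shows "(A * dg n d) $$ (i,j) = A $$ (i,j) * complex_of_real (d j)"
proof -
  have "(A * dg n d) $$ (i,j) = (\<Sum>k<n. A $$ (i,k) * (if k = j then complex_of_real (d k) else 0))"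
    using assms by (simp add: mult_idx dg_def del: index_mult_mat(1))
  also have "\<dots> = (\<Sum>k<n. if k = j then A $$ (i,k) * complex_of_real (d k) else 0)"
    by (rule sum.cong) auto
  finally show ?thesis using assms by simp
qed

lemma dg_mult_idx:
  assumes "i < n" "j < dim_col A" "dim_row A = n"
  shows "(dg n d * A) $$ (i,j) = complex_of_real (d i) * A $$ (i,j)"
proof -
  have "(dg n d * A) $$ (i,j) = (\<Sum>k<n. (if i = k then complex_of_real (d i) else 0) * A $$ (k,j))"
    using assms by (simp add: mult_idx dg_def del: index_mult_mat(1))
  also have "\<dots> = (\<Sum>k<n. if i = k then complex_of_real (d i) * A $$ (k,j) else 0)"
    by (rule sum.cong) auto
  finally show ?thesis using assms by simp
qed

lemma dg_mult_dg: "dg n d * dg n e = dg n (\<lambda>i. d i * e i)"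
  by (rule eq_matI) (auto simp: mult_dg_idx simp del: index_mult_mat(1), auto simp: dg_def)

lemma conj_dg_idx:
  assumes "dim_col U = n" "dim_col V = n" "i < dim_row U" "j < dim_row V"
  shows "(U * dg n d * adj V) $$ (i,j) = (\<Sum>k<n. U $$ (i,k) * complex_of_real (d k) * cnj (V $$ (j,k)))"
  using assms by (subst mult_idx) (auto simp: mult_dg_idx simp del: index_mult_mat(1))

text \<open>Complete \<open>v\<close> to a basis, orthogonalise and normalise. Gram-Schmidt leaves
  the first vector alone, so only the normalising factor \<open>c\<close> separates it from
  \<open>v\<close>.\<close>

lemma unitary_column:
  assumes v: "v \<in> carrier_vec n" and v0: "v \<noteq> 0\<^sub>v n"
  obtains W c where "unitary n W" "\<And>i. i < n \<Longrightarrow> W $$ (i,0) = c * v $ i"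
proof -
  interpret cof_vec_space n "TYPE(complex)" .
  have n: "0 < n"
  proof (rule ccontr)
    assume "\<not> 0 < n"
    hence "v = 0\<^sub>v n" by (intro eq_vecI) (use v in auto)
    thus False using v0 by simp
  qed
  define b where "b = basis_completion v"
  define ws where "ws = gram_schmidt n b"
  from basis_completion[OF v v0, folded b_def]
  have dist_b: "distinct b" and indep: "\<not> lin_dep (set b)" and b: "set b \<subseteq> carrier_vec n"
    and hdb: "hd b = v" and len_b: "length b = n" by auto
  from hdb len_b n obtain vs where bv: "b = v # vs" by (cases b) auto
  from gram_schmidt_result[OF b dist_b indep refl, folded ws_def]
  have ws: "set ws \<subseteq> carrier_vec n" and orth: "corthogonal ws" and len: "length ws = n"
    by (auto simp: len_b)
  have "hd ws = v" using gram_schmidt_hd[OF v, of vs, folded bv] unfolding ws_def .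
  hence ws0: "ws ! 0 = v" using len n by (cases ws) auto
  have wsd: "dim_vec (ws ! j) = n" if "j < n" for j
    using subsetD[OF ws nth_mem[of j ws]] len that by simp
  have sp: "ws ! j \<bullet>c ws ! i = (\<Sum>k<n. ws ! j $ k * cnj (ws ! i $ k))" if "i < n" "j < n" for i j
    using wsd that by (simp add: scalar_prod_def lessThan_atLeast0)
  define q where "q j = (\<Sum>k<n. (cmod (ws ! j $ k))\<^sup>2)" for j
  have qsp: "complex_of_real (q j) = ws ! j \<bullet>c ws ! j" if "j < n" for j
    using that by (simp add: sp q_def complex_norm_square[symmetric])
  have q0: "0 < q j" if "j < n" for j
  proof -
    have "q j \<noteq> 0" using corthogonalD[OF orth, of j j] that len qsp[OF that] by auto
    moreover have "0 \<le> q j" unfolding q_def by (rule sum_nonneg) simp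
    ultimately show ?thesis by simp
  qed
  define W where "W = mat n n (\<lambda>(i,j). ws ! j $ i / complex_of_real (sqrt (q j)))"
  have "unitary n W"
    unfolding unitary_def
  proof
    show "W \<in> carrier_mat n n" by (simp add: W_def)
    show "adj W * W = 1\<^sub>m n"
    proof (rule eq_matI)
      fix i j assume "i < dim_row (1\<^sub>m n :: complex mat)" "j < dim_col (1\<^sub>m n :: complex mat)"
      hence i: "i < n" and j: "j < n" by auto
      have "(adj W * W) $$ (i,j) = (\<Sum>k<n. cnj (W $$ (k,i)) * W $$ (k,j))"
        using i j by (subst mult_idx) (auto simp: W_def)
      also have "\<dots> = (\<Sum>k<n. ws ! j $ k * cnj (ws ! i $ k)) / (complex_of_real (sqrt (q i)) * complex_of_real (sqrt (q j)))"
        unfolding sum_divide_distrib by (rule sum.cong) (use i j in \<open>auto simp: W_def\<close>)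
      also have "\<dots> = ws ! j \<bullet>c ws ! i / (complex_of_real (sqrt (q i)) * complex_of_real (sqrt (q j)))"
        using sp i j by simp
      also have "\<dots> = (if i = j then 1 else 0)"
      proof (cases "i = j")
        case True
        have "complex_of_real (sqrt (q j)) * complex_of_real (sqrt (q j)) = complex_of_real (q j)"
          using q0[OF j] by (simp flip: of_real_mult)
        thus ?thesis using True q0[OF j] by (simp add: qsp[OF j, symmetric])
      next
        case False
        thus ?thesis using corthogonalD[OF orth, of j i] i j len by auto
      qed
      finally show "(adj W * W) $$ (i,j) = 1\<^sub>m n $$ (i,j)" using i j by simp
    qed (simp_all add: W_def)
  qed
  moreover have "W $$ (i,0) = (1 / complex_of_real (sqrt (q 0))) * v $ i" if "i < n" for i
    using that n ws0 by (simp add: W_def)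
  ultimately show ?thesis by (rule that)
qed

text \<open>Deflation: a unitary \<open>W\<close> with an eigenvector as first column clears the
  rest of the first column of the matrix, self-adjointness clears the first row and makes the
  eigenvalue real, and a self-adjoint block of size \<open>n\<close> remains.\<close>

theorem spectral_theorem:
  assumes "A \<in> carrier_mat n n" "adj A = A"
  shows "\<exists>U d. unitary n U \<and> A = U * dg n d * adj U"
  using assms
proof (induction n arbitrary: A)
  case 0
  have "A = 1\<^sub>m 0 * dg 0 (\<lambda>_. 0) * adj (1\<^sub>m 0)" by (rule eq_matI) (use 0 in auto)
  thus ?case using unitary_one by blast
next
  case (Suc n)
  let ?m = "Suc n"
  note A = Suc.prems
  have dA: "dim_row A = ?m" "dim_col A = ?m" using A by auto
  obtain e where "eigenvalue A e"
    using spectrum_non_empty[OF A(1)] by (auto simp: spectrum_def)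
  then obtain v where v: "v \<in> carrier_vec ?m" "v \<noteq> 0\<^sub>v ?m" and Av: "A *\<^sub>v v = e \<cdot>\<^sub>v v"
    using dA by (auto simp: eigenvalue_def eigenvector_def)
  obtain W c where W: "unitary ?m W" and W0: "\<And>i. i < ?m \<Longrightarrow> W $$ (i,0) = c * v $ i"
    by (rule unitary_column[OF v]) blast
  note dW = unitary_dim[OF W]
  define A' where "A' = adj W * (A * W)"
  have dA': "dim_row A' = ?m" "dim_col A' = ?m" by (simp_all add: A'_def dW)
  have hA': "adj A' = A'" by (simp add: A'_def adj_mult assoc_dim dW dA A(2))
  have AW: "(A * W) $$ (i,0) = e * W $$ (i,0)" if i: "i < ?m" for i
  proof -
    have "(A * W) $$ (i,0) = (\<Sum>k<?m. A $$ (i,k) * (c * v $ k))"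
      using i by (subst mult_idx) (auto simp: dA dW W0)
    also have "\<dots> = c * (A *\<^sub>v v) $ i"
      using i v by (simp add: dA scalar_prod_def lessThan_atLeast0 sum_distrib_left mult.left_commute del: sum.lessThan_Suc sum.op_ivl_Suc)
    also have "\<dots> = e * W $$ (i,0)" using i v by (simp add: Av W0)
    finally show ?thesis .
  qed
  have A'0: "A' $$ (i,0) = (if i = 0 then e else 0)" if i: "i < ?m" for i
  proof -
    have "A' $$ (i,0) = (\<Sum>k<?m. adj W $$ (i,k) * (e * W $$ (k,0)))"
      unfolding A'_def using i by (subst mult_idx) (auto simp: dA dW AW simp del: sum.lessThan_Suc index_mult_mat(1))
    also have "\<dots> = e * (adj W * W) $$ (i,0)"
      using i by (subst mult_idx) (auto simp: dW sum_distrib_left mult.left_commute simp del: sum.lessThan_Suc)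
    finally show ?thesis using i by (simp add: unitary_left[OF W])
  qed
  have A'sym: "cnj (A' $$ (j,i)) = A' $$ (i,j)" if "i < ?m" "j < ?m" for i j
    using that dA' by (metis adj_index hA')
  have "cnj e = e" using A'sym[of 0 0] A'0[of 0] by simp
  then obtain e' where e: "e = complex_of_real e'" by (metis Reals_cases Reals_cnj_iff)
  have A'0': "A' $$ (0,j) = (if j = 0 then e else 0)" if "j < ?m" for j
    using A'sym[of 0 j] A'0[OF that] e that by (cases "j = 0") auto
  define A3 where "A3 = mat n n (\<lambda>(i,j). A' $$ (Suc i, Suc j))"
  have "A3 \<in> carrier_mat n n" by (simp add: A3_def)
  moreover have "adj A3 = A3" by (rule eq_matI) (auto simp: A3_def A'sym)
  ultimately obtain U3 d where U3: "unitary n U3" and A3: "A3 = U3 * dg n d * adj U3"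
    using Suc.IH by blast
  note d3 = unitary_dim[OF U3]
  \<comment> \<open>The block sum of 1 and \<open>U3\<close>; the shift by one in the indices makes
    room for the eigenvector already split off.\<close>
  define V where "V = mat ?m ?m (\<lambda>(i,j). if i = 0 \<or> j = 0 then (if i = j then 1 else 0) else U3 $$ (i - 1, j - 1))"
  have dV: "dim_row V = ?m" "dim_col V = ?m" by (simp_all add: V_def)
  define d' where "d' i = (if i = 0 then e' else d (i - 1))" for i
  have V: "unitary ?m V"
    unfolding unitary_def
  proof
    show "V \<in> carrier_mat ?m ?m" by (simp add: V_def)
    show "adj V * V = 1\<^sub>m ?m"
    proof (rule eq_matI)
      fix i j assume "i < dim_row (1\<^sub>m ?m :: complex mat)" "j < dim_col (1\<^sub>m ?m :: complex mat)"
      hence i: "i < ?m" and j: "j < ?m" by auto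
      have "(adj V * V) $$ (i,j) = (\<Sum>k<?m. cnj (V $$ (k,i)) * V $$ (k,j))"
        using i j by (subst mult_idx) (auto simp: dV simp del: sum.lessThan_Suc)
      also have "\<dots> = cnj (V $$ (0,i)) * V $$ (0,j) + (\<Sum>k<n. cnj (V $$ (Suc k,i)) * V $$ (Suc k,j))"
        by (rule sum.lessThan_Suc_shift)
      also have "\<dots> = 1\<^sub>m ?m $$ (i,j)"
      proof (cases "i = 0 \<or> j = 0")
        case True
        thus ?thesis using i j by (auto simp: V_def)
      next
        case False
        then obtain i' j' where ij: "i = Suc i'" "j = Suc j'" "i' < n" "j' < n"
          using i j by (metis Suc_less_eq not0_implies_Suc)
        have "(\<Sum>k<n. cnj (V $$ (Suc k,i)) * V $$ (Suc k,j)) = (adj U3 * U3) $$ (i',j')"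
          using ij by (subst mult_idx) (auto simp: d3 V_def)
        thus ?thesis using ij by (simp add: unitary_left[OF U3]) (simp add: V_def)
      qed
      finally show "(adj V * V) $$ (i,j) = 1\<^sub>m ?m $$ (i,j)" .
    qed (simp_all add: V_def)
  qed
  have A'V: "A' = V * dg ?m d' * adj V"
  proof (rule eq_matI)
    fix i j assume "i < dim_row (V * dg ?m d' * adj V)" "j < dim_col (V * dg ?m d' * adj V)"
    hence i: "i < ?m" and j: "j < ?m" by (auto simp: dV)
    have "(V * dg ?m d' * adj V) $$ (i,j) = (\<Sum>k<?m. V $$ (i,k) * complex_of_real (d' k) * cnj (V $$ (j,k)))"
      using i j dV by (intro conj_dg_idx) auto
    also have "\<dots> = V $$ (i,0) * complex_of_real (d' 0) * cnj (V $$ (j,0)) +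
        (\<Sum>k<n. V $$ (i,Suc k) * complex_of_real (d' (Suc k)) * cnj (V $$ (j,Suc k)))"
      by (rule sum.lessThan_Suc_shift)
    also have "\<dots> = A' $$ (i,j)"
    proof (cases "i = 0 \<or> j = 0")
      case True
      thus ?thesis using i j A'0 A'0' e by (auto simp: V_def d'_def)
    next
      case False
      then obtain i' j' where ij: "i = Suc i'" "j = Suc j'" "i' < n" "j' < n"
        using i j by (metis Suc_less_eq not0_implies_Suc)
      have "(\<Sum>k<n. V $$ (i,Suc k) * complex_of_real (d' (Suc k)) * cnj (V $$ (j,Suc k))) = A3 $$ (i',j')"
        unfolding A3 using ij by (subst conj_dg_idx) (auto simp: d3 V_def d'_def)
      moreover have "V $$ (i,0) = 0" using ij by (simp add: V_def)
      ultimately show ?thesis using ij by (simp add: A3_def)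
    qed
    finally show "A' $$ (i,j) = (V * dg ?m d' * adj V) $$ (i,j)" by simp
  qed (simp_all add: dA' dV)
  have "W * (adj W * (A * (W * adj W))) = A"
    using mult_cancel_dim[OF unitary_right[OF W], of "A * (W * adj W)"]
    by (simp add: dW dA unitary_right[OF W] mult_one_dim)
  hence "A = W * (A' * adj W)" by (simp add: A'_def assoc_dim dW dA)
  also have "\<dots> = (W * V) * dg ?m d' * adj (W * V)"
    unfolding A'V by (simp add: adj_mult assoc_dim dW dV)
  finally show ?case using unitary_mult[OF W V] by blast
qed

section \<open>Functional calculus and trace inequalities\<close>

text \<open>The eigenvalues carry no order, so \<open>U\<close> and \<open>d\<close> are witnesses
  and not functions of \<open>A\<close>; statements about \<open>A\<close> must hold for every such
  pair.\<close>

definition eig :: "nat \<Rightarrow> complex mat \<Rightarrow> complex mat \<Rightarrow> (nat \<Rightarrow> real) \<Rightarrow> bool" where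
  "eig n A U d \<longleftrightarrow> unitary n U \<and> A = U * dg n d * adj U"

lemma eig_dim:
  assumes "eig n A U d"
  shows "dim_row A = n" "dim_col A = n" "dim_row U = n" "dim_col U = n" "adj A = A"
proof -
  note u = unitary_dim[of n U]
  show "dim_row U = n" "dim_col U = n" using assms u by (auto simp: eig_def)
  thus "dim_row A = n" "dim_col A = n" "adj A = A"
    using assms by (auto simp: eig_def adj_mult assoc_dim)
qed

text \<open>The overlap M = \<open>adj V * U\<close> intertwines the two diagonal matrices, so its
  (i,j) entry vanishes unless d j = e i. Hence M also intertwines their images under
  \<open>f\<close>.\<close>

lemma eig_unique:
  assumes U: "unitary n U" and V: "unitary n V" and eq: "U * dg n d * adj U = V * dg n e * adj V"
  shows "U * dg n (\<lambda>i. f (d i)) * adj U = V * dg n (\<lambda>i. f (e i)) * adj V"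
proof -
  note D = unitary_dim[OF U] unitary_dim[OF V]
  note cU = mult_cancel_dim[OF unitary_left[OF U]] and cV = mult_cancel_dim[OF unitary_left[OF V]]
    and cV' = mult_cancel_dim[OF unitary_right[OF V]]
  define M where "M = adj V * U"
  have dM: "dim_row M = n" "dim_col M = n" by (simp_all add: M_def D)
  have "M * dg n d = adj V * (U * dg n d * adj U) * U"
    by (simp add: M_def assoc_dim D unitary_left[OF U] mult_one_dim)
  also have "\<dots> = dg n e * M"
    unfolding eq by (simp add: M_def assoc_dim D cV)
  finally have Md: "M * dg n d = dg n e * M" .
  have "M * dg n (\<lambda>i. f (d i)) = dg n (\<lambda>i. f (e i)) * M"
  proof (rule eq_matI)
    fix i j assume "i < dim_row (dg n (\<lambda>i. f (e i)) * M)" "j < dim_col (dg n (\<lambda>i. f (e i)) * M)"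
    hence i: "i < n" and j: "j < n" by (simp_all add: dM)
    have "M $$ (i,j) * complex_of_real (d j) = complex_of_real (e i) * M $$ (i,j)"
      using arg_cong[OF Md, of "\<lambda>X. X $$ (i,j)"] i j dM
      by (simp add: mult_dg_idx dg_mult_idx del: index_mult_mat(1))
    hence "M $$ (i,j) = 0 \<or> d j = e i" by (simp add: mult.commute)
    thus "(M * dg n (\<lambda>i. f (d i))) $$ (i,j) = (dg n (\<lambda>i. f (e i)) * M) $$ (i,j)"
      using i j dM by (auto simp: mult_dg_idx dg_mult_idx simp del: index_mult_mat(1))
  qed (simp_all add: dM)
  hence "V * (M * dg n (\<lambda>i. f (d i))) * adj U = V * (dg n (\<lambda>i. f (e i)) * M) * adj U" by simp
  thus ?thesis by (simp add: M_def assoc_dim D cV' unitary_right[OF U] mult_one_dim)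
qed

text \<open>This resolves the choice operator in \<open>mfun\<close>: by \<open>eig_unique\<close>
  all admissible values coincide, so any decomposition at hand may be used.\<close>

lemma eig_mfun:
  assumes "eig n A U d"
  shows "mfun f A = U * dg n (\<lambda>i. f (d i)) * adj U"
proof -
  have U: "unitary n U" and A: "A = U * dg n d * adj U" using assms by (auto simp: eig_def)
  have dA: "dim_row A = n" using eig_dim[OF assms] by simp
  let ?P = "\<lambda>B. \<exists>U D. unitary n U \<and> D \<in> carrier_mat n n \<and> diagonal_mat D \<and> (\<forall>i < n. D $$ (i,i) \<in> \<real>)
      \<and> A = U * D * adj U \<and> B = U * dg n (\<lambda>i. f (Re (D $$ (i,i)))) * adj U"
  have "?P (U * dg n (\<lambda>i. f (d i)) * adj U)"
  proof (intro exI conjI)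
    show "U * dg n (\<lambda>i. f (d i)) * adj U = U * dg n (\<lambda>i. f (Re (dg n d $$ (i,i)))) * adj U"
      by (subst dg_cong[of n "\<lambda>i. f (d i)" "\<lambda>i. f (Re (dg n d $$ (i,i)))"]) (auto simp: dg_def)
  qed (use U A in \<open>auto simp: dg_def diagonal_mat_def\<close>)
  hence "?P (SOME B. ?P B)" by (rule someI)
  moreover have "mfun f A = (SOME B. ?P B)" by (simp add: mfun_def dA dg_def)
  ultimately obtain V D where V: "unitary n V" and D: "D \<in> carrier_mat n n" "diagonal_mat D"
    and r: "\<forall>i < n. D $$ (i,i) \<in> \<real>" and AV: "A = V * D * adj V"
    and m: "mfun f A = V * dg n (\<lambda>i. f (Re (D $$ (i,i)))) * adj V" by auto
  have "D = dg n (\<lambda>i. Re (D $$ (i,i)))"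
    by (rule eq_matI) (use D r in \<open>auto simp: dg_def diagonal_mat_def\<close>)
  with AV A have "V * dg n (\<lambda>i. Re (D $$ (i,i))) * adj V = U * dg n d * adj U" by simp
  from eig_unique[OF V U this, of f] m show ?thesis by simp
qed

lemma eig_mfun_eig: "eig n A U d \<Longrightarrow> eig n (mfun f A) U (\<lambda>i. f (d i))"
  by (simp add: eig_mfun) (simp add: eig_def)

lemma eig_one: "unitary n U \<Longrightarrow> eig n (1\<^sub>m n) U (\<lambda>_. 1)"
  using unitary_dim[of n U] unitary_right[of n U] by (simp add: eig_def dg_one mult_one_dim)

lemma eig_conj:
  assumes "eig n A U d" "unitary n V"
  shows "eig n (V * A * adj V) (V * U) d"
  using assms unitary_mult[OF assms(2), of U] eig_dim[OF assms(1)] unitary_dim[OF assms(2)]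
  by (auto simp: eig_def adj_mult assoc_dim)

section \<open>Quadratic forms and positive definiteness\<close>

lemma herm_form_conj:
  assumes "dim_col C = dim_row A" "dim_col A = dim_row A" "v \<in> carrier_vec (dim_row C)"
  shows "herm_form (C * A * adj C) v = herm_form A (adj C *\<^sub>v v)"
proof -
  define w where "w = A *\<^sub>v (adj C *\<^sub>v v)"
  have dv: "dim_vec v = dim_row C" using assms by simp
  have dw: "dim_vec w = dim_row A" by (simp add: w_def)
  have cw: "adj C *\<^sub>v v \<in> carrier_vec (dim_row A)" by (rule carrier_vecI) (simp add: assms)
  have cC: "C \<in> carrier_mat (dim_row C) (dim_row A)" "A \<in> carrier_mat (dim_row A) (dim_row A)"
    "adj C \<in> carrier_mat (dim_row A) (dim_row C)" by (auto intro!: carrier_matI simp: assms)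
  have "(C * A * adj C) *\<^sub>v v = (C * A) *\<^sub>v (adj C *\<^sub>v v)"
    by (rule assoc_mult_mat_vec[OF mult_carrier_mat[OF cC(1,2)] cC(3) assms(3)])
  also have "\<dots> = C *\<^sub>v w"
    unfolding w_def by (rule assoc_mult_mat_vec[OF cC(1,2) cw])
  finally have "(C * A * adj C) *\<^sub>v v = C *\<^sub>v w" .
  hence "herm_form (C * A * adj C) v = (\<Sum>i<dim_row C. cnj (v $ i) * (\<Sum>j<dim_row A. C $$ (i,j) * w $ j))"
    using assms dv dw by (simp add: herm_form_def scalar_prod_def lessThan_atLeast0)
  also have "\<dots> = (\<Sum>j<dim_row A. \<Sum>i<dim_row C. cnj (v $ i) * C $$ (i,j) * w $ j)"
    by (subst sum.swap) (simp add: sum_distrib_left mult.assoc)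
  also have "\<dots> = (\<Sum>j<dim_row A. cnj ((adj C *\<^sub>v v) $ j) * w $ j)"
    using assms dv by (intro sum.cong)
      (auto simp: scalar_prod_def lessThan_atLeast0 sum_distrib_left sum_distrib_right mult_ac)
  also have "\<dots> = herm_form A (adj C *\<^sub>v v)"
    using assms by (simp add: herm_form_def w_def)
  finally show ?thesis .
qed

lemma herm_form_dg:
  assumes "w \<in> carrier_vec n"
  shows "Re (herm_form (dg n d) w) = (\<Sum>i<n. d i * (cmod (w $ i))\<^sup>2)"
proof -
  have "(dg n d *\<^sub>v w) $ i = complex_of_real (d i) * w $ i" if i: "i < n" for i
  proof -
    have "(dg n d *\<^sub>v w) $ i = (\<Sum>k<n. (if i = k then complex_of_real (d i) else 0) * w $ k)"
      using i assms by (simp add: scalar_prod_def lessThan_atLeast0 dg_def)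
    also have "\<dots> = (\<Sum>k<n. if i = k then complex_of_real (d i) * w $ k else 0)"
      by (rule sum.cong) auto
    finally show ?thesis using i by simp
  qed
  hence "herm_form (dg n d) w = (\<Sum>i<n. cnj (w $ i) * (complex_of_real (d i) * w $ i))"
    using assms by (simp add: herm_form_def)
  also have "\<dots> = (\<Sum>i<n. complex_of_real (d i * (cmod (w $ i))\<^sup>2))"
    by (rule sum.cong) (auto simp: complex_norm_square simp del: of_real_power)
  also have "\<dots> = complex_of_real (\<Sum>i<n. d i * (cmod (w $ i))\<^sup>2)" by simp
  finally show ?thesis by (simp only: Re_complex_of_real)
qed

text \<open>The i-th column of \<open>U\<close> is the test vector; through it the sign of the form
  is read off as the sign of the eigenvalues.\<close>

lemma eig_herm_form:
  assumes "eig n A U d" "i < n"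
  obtains v where "v \<in> carrier_vec n" "v \<noteq> 0\<^sub>v n" "Re (herm_form A v) = d i"
proof -
  have U: "unitary n U" and A: "A = U * dg n d * adj U" using assms by (auto simp: eig_def)
  note D = eig_dim[OF assms(1)]
  define v where "v = U *\<^sub>v unit_vec n i"
  have cU: "U \<in> carrier_mat n n" using U by (simp add: unitary_def)
  have v: "v \<in> carrier_vec n" using cU by (simp add: v_def)
  have "adj U *\<^sub>v v = (adj U * U) *\<^sub>v unit_vec n i"
    unfolding v_def using cU by (intro assoc_mult_mat_vec[symmetric]) auto
  hence Uv: "adj U *\<^sub>v v = unit_vec n i" by (simp add: unitary_left[OF U])
  have "Re (herm_form A v) = Re (herm_form (dg n d) (unit_vec n i))"
    unfolding A using v D by (subst herm_form_conj) (auto simp: Uv)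
  also have "\<dots> = (\<Sum>k<n. d k * (cmod (unit_vec n i $ k))\<^sup>2)" by (rule herm_form_dg) simp
  also have "\<dots> = (\<Sum>k<n. if k = i then d k else 0)"
    by (rule sum.cong) (use assms(2) in auto)
  finally have "Re (herm_form A v) = d i" using assms(2) by simp
  moreover have "v \<noteq> 0\<^sub>v n"
  proof
    assume "v = 0\<^sub>v n"
    moreover have "adj U *\<^sub>v 0\<^sub>v n = 0\<^sub>v n" by (rule eq_vecI) (auto simp: D scalar_prod_def)
    ultimately have "unit_vec n i = (0\<^sub>v n :: complex vec)" using Uv by simp
    hence "unit_vec n i $ i = (0\<^sub>v n :: complex vec) $ i" by simp
    thus False using assms(2) by simp
  qed
  ultimately show ?thesis using v that by blast
qed

lemma pos_defD:
  assumes "pos_def n A"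
  shows "dim_row A = n" "dim_col A = n" "adj A = A" "A \<in> carrier_mat n n"
  using assms by (auto simp: pos_def_def)

lemma pos_def_eig:
  assumes "pos_def n A"
  obtains U d where "eig n A U d" "\<And>i. i < n \<Longrightarrow> 0 < d i"
proof -
  obtain U d where e: "eig n A U d"
    using spectral_theorem[of A n] assms by (auto simp: pos_def_def eig_def)
  have "0 < d i" if "i < n" for i
    by (rule eig_herm_form[OF e that]) (use assms in \<open>auto simp: pos_def_def\<close>)
  thus ?thesis using e that by blast
qed

lemma pos_semidef_eig:
  assumes "pos_semidef n A"
  obtains U d where "eig n A U d" "\<And>i. i < n \<Longrightarrow> 0 \<le> d i"
proof -
  obtain U d where e: "eig n A U d"
    using spectral_theorem[of A n] assms by (auto simp: pos_semidef_def eig_def)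
  have "0 \<le> d i" if "i < n" for i
    by (rule eig_herm_form[OF e that]) (use assms in \<open>auto simp: pos_semidef_def\<close>)
  thus ?thesis using e that by blast
qed

text \<open>\<open>G\<close> is a left inverse of \<open>adj C\<close>, so a nonzero vector stays
  nonzero when it is moved into the form of \<open>A\<close>.\<close>

lemma pos_def_congruence:
  assumes A: "pos_def k A" and C: "dim_row C = n" "dim_col C = k"
    and G: "G * adj C = 1\<^sub>m n" "dim_col G = k"
  shows "pos_def n (C * A * adj C)"
  unfolding pos_def_def
proof (intro conjI ballI impI)
  note D = pos_defD[OF A]
  show "C * A * adj C \<in> carrier_mat n n" by (rule carrier_matI) (simp_all add: C)
  show "adj (C * A * adj C) = C * A * adj C" by (simp add: adj_mult assoc_dim C D)
  fix v :: "complex vec" assume v: "v \<in> carrier_vec n" "v \<noteq> 0\<^sub>v n"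
  have "dim_row (G * adj C) = n" by (simp only: G index_one_mat)
  hence dG: "dim_row G = n" by simp
  have w: "adj C *\<^sub>v v \<in> carrier_vec k" by (rule carrier_vecI) (simp add: C)
  have "G *\<^sub>v (adj C *\<^sub>v v) = (G * adj C) *\<^sub>v v"
    by (rule assoc_mult_mat_vec[symmetric, of _ n k _ n]) (auto intro!: carrier_matI simp: dG G C v)
  also have "\<dots> = v" using v by (simp add: G)
  finally have Gv: "G *\<^sub>v (adj C *\<^sub>v v) = v" .
  have "adj C *\<^sub>v v \<noteq> 0\<^sub>v k"
  proof
    assume "adj C *\<^sub>v v = 0\<^sub>v k"
    hence "v = G *\<^sub>v 0\<^sub>v k" using Gv by simp
    also have "\<dots> = 0\<^sub>v n" by (rule eq_vecI) (auto simp: dG G scalar_prod_def)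
    finally show False using v by simp
  qed
  hence "0 < Re (herm_form A (adj C *\<^sub>v v))" using A w by (simp add: pos_def_def)
  thus "0 < Re (herm_form (C * A * adj C) v)"
    using v C D by (subst herm_form_conj) auto
qed

lemma eig_pos_def:
  assumes "eig n A U d" "\<And>i. i < n \<Longrightarrow> 0 < d i"
  shows "pos_def n A"
proof -
  have U: "unitary n U" and A: "A = U * dg n d * adj U" using assms by (auto simp: eig_def)
  have "pos_def n (dg n d)"
    unfolding pos_def_def
  proof (intro conjI ballI impI)
    show "dg n d \<in> carrier_mat n n" by (simp add: dg_def)
    fix v :: "complex vec" assume v: "v \<in> carrier_vec n" "v \<noteq> 0\<^sub>v n"
    then obtain i where i: "i < n" "v $ i \<noteq> 0" by (metis carrier_vecD eq_vecI index_zero_vec)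
    have "0 < (\<Sum>i<n. d i * (cmod (v $ i))\<^sup>2)"
      by (rule sum_pos2[of _ i]) (use i assms(2) in \<open>auto simp: less_imp_le\<close>)
    thus "0 < Re (herm_form (dg n d) v)" using v by (simp add: herm_form_dg)
  qed simp
  from pos_def_congruence[OF this, of U n U] show ?thesis
    using unitary_dim[OF U] unitary_right[OF U] by (simp add: A)
qed

lemma pos_def_mfun:
  assumes "pos_def n A" "\<And>x. 0 < x \<Longrightarrow> 0 < f x"
  shows "pos_def n (mfun f A)"
proof -
  obtain U d where e: "eig n A U d" "\<And>i. i < n \<Longrightarrow> 0 < d i" using pos_def_eig[OF assms(1)] by blast
  show ?thesis by (rule eig_pos_def[OF eig_mfun_eig[OF e(1)]]) (use e assms in auto)
qed

lemma mfun_cong: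
  assumes "pos_def n A" "\<And>x. 0 < x \<Longrightarrow> f x = g x"
  shows "mfun f A = mfun g A"
proof -
  obtain U d where e: "eig n A U d" "\<And>i. i < n \<Longrightarrow> 0 < d i" using pos_def_eig[OF assms(1)] by blast
  have "dg n (\<lambda>i. f (d i)) = dg n (\<lambda>i. g (d i))" by (rule dg_cong) (use e assms in auto)
  thus ?thesis by (simp add: eig_mfun[OF e(1)])
qed

lemma mfun_mult:
  assumes "pos_def n A"
  shows "mfun f A * mfun g A = mfun (\<lambda>x. f x * g x) A"
proof -
  obtain U d where e: "eig n A U d" using pos_def_eig[OF assms] by blast
  have U: "unitary n U" using e by (simp add: eig_def)
  note D = unitary_dim[OF U]
  have "mfun f A * mfun g A = U * (dg n (\<lambda>i. f (d i)) * (adj U * (U * (dg n (\<lambda>i. g (d i)) * adj U))))"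
    by (simp add: eig_mfun[OF e] assoc_dim D)
  also have "\<dots> = U * (dg n (\<lambda>i. f (d i)) * dg n (\<lambda>i. g (d i))) * adj U"
    by (simp add: mult_cancel_dim[OF unitary_left[OF U]] assoc_dim D)
  finally show ?thesis by (simp add: dg_mult_dg eig_mfun[OF e])
qed

lemma mfun_mfun:
  assumes "pos_def n A"
  shows "mfun f (mfun g A) = mfun (\<lambda>x. f (g x)) A"
proof -
  obtain U d where e: "eig n A U d" using pos_def_eig[OF assms] by blast
  show ?thesis
    by (rule trans[OF eig_mfun[OF eig_mfun_eig[OF e]] eig_mfun[OF e, symmetric]])
qed

lemma mfun_ident:
  assumes "pos_def n A"
  shows "mfun (\<lambda>x. x) A = A"
proof -
  obtain U d where e: "eig n A U d" using pos_def_eig[OF assms] by blast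
  show ?thesis unfolding eig_mfun[OF e] using e by (simp add: eig_def)
qed

lemma mfun_const:
  assumes "pos_def n A"
  shows "mfun (\<lambda>x. 1) A = 1\<^sub>m n"
proof -
  obtain U d where e: "eig n A U d" using pos_def_eig[OF assms] by blast
  hence "unitary n U" by (simp add: eig_def)
  thus ?thesis unfolding eig_mfun[OF e] using eig_one[of n U] by (simp add: eig_def)
qed

lemma mfun_dim:
  assumes "pos_def n A"
  shows "dim_row (mfun f A) = n" "dim_col (mfun f A) = n" "adj (mfun f A) = mfun f A"
proof -
  obtain U d where e: "eig n A U d" using pos_def_eig[OF assms] by blast
  show "dim_row (mfun f A) = n" "dim_col (mfun f A) = n" "adj (mfun f A) = mfun f A"
    using eig_dim[OF eig_mfun_eig[OF e]] by auto
qed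

lemma mfun_conj:
  assumes "pos_def n A" "unitary n V"
  shows "mfun f (V * A * adj V) = V * mfun f A * adj V"
proof -
  obtain U d where e: "eig n A U d" using pos_def_eig[OF assms(1)] by blast
  show ?thesis
    unfolding eig_mfun[OF eig_conj[OF e assms(2)]] eig_mfun[OF e]
    using eig_dim[OF e] unitary_dim[OF assms(2)] by (simp add: adj_mult assoc_dim)
qed

lemma pos_def_mpow: "pos_def n A \<Longrightarrow> pos_def n (mpow A p)"
  unfolding mpow_def by (rule pos_def_mfun) auto

lemma mpow_dim:
  assumes "pos_def n A"
  shows "dim_row (mpow A p) = n" "dim_col (mpow A p) = n" "adj (mpow A p) = mpow A p"
  using pos_defD[OF pos_def_mpow[OF assms]] by auto

lemma mpow_mult: "pos_def n A \<Longrightarrow> mpow A p * mpow A q = mpow A (p + q)"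
  unfolding mpow_def by (simp add: mfun_mult) (rule mfun_cong, auto simp: powr_add)

lemma mpow_0: "pos_def n A \<Longrightarrow> mpow A 0 = 1\<^sub>m n"
  unfolding mpow_def by (subst mfun_cong[of n _ _ "\<lambda>x. 1"]) (auto simp: mfun_const)

lemma mpow_1: "pos_def n A \<Longrightarrow> mpow A 1 = A"
  unfolding mpow_def by (subst mfun_cong[of n _ _ "\<lambda>x. x"]) (auto simp: mfun_ident)

lemma mpow_mpow: "pos_def n A \<Longrightarrow> mpow (mpow A p) q = mpow A (p * q)"
  unfolding mpow_def by (simp add: mfun_mfun powr_powr)

section \<open>Traces in eigenbases\<close>

lemma mtrace_eig:
  assumes "eig n A U d"
  shows "mtrace A = complex_of_real (\<Sum>i<n. d i)"
proof -
  have U: "unitary n U" and A: "A = U * dg n d * adj U" using assms by (auto simp: eig_def)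
  note D = unitary_dim[OF U]
  have "mtrace A = mtrace (adj U * (U * dg n d))"
    unfolding A by (rule mtrace_mult_comm) (simp_all add: D)
  also have "adj U * (U * dg n d) = dg n d"
    by (rule mult_cancel_dim[OF unitary_left[OF U]]) (simp_all add: D)
  finally show ?thesis by (simp add: mtrace_def dg_def)
qed

text \<open>The bridge from scalars to traces: in the two eigenbases the trace is a sum of products
  of eigenvalues, with nonnegative weights in which \<open>S\<close> alone is weighed against the
  bases.\<close>

lemma mtrace_eig_eig:
  assumes X: "eig n X U x" and Y: "eig m Y V y" and S: "dim_row S = n" "dim_col S = m"
  shows "Re (mtrace (adj S * X * S * Y)) = (\<Sum>i<n. \<Sum>j<m. x i * y j * (cmod ((adj U * S * V) $$ (i,j)))\<^sup>2)"
proof -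
  note D = eig_dim[OF X] eig_dim[OF Y] S
  have X': "X = U * dg n x * adj U" and Y': "Y = V * dg m y * adj V" using X Y by (auto simp: eig_def)
  define M where "M = adj U * S * V"
  have dM: "dim_row M = n" "dim_col M = m" by (simp_all add: M_def D)
  have "mtrace (adj S * X * S * Y) = mtrace ((adj S * U * dg n x * adj U * S * V * dg m y) * adj V)"
    unfolding X' Y' by (simp add: assoc_dim D)
  also have "\<dots> = mtrace (adj V * (adj S * U * dg n x * adj U * S * V * dg m y))"
    by (rule mtrace_mult_comm) (simp_all add: D)
  also have "adj V * (adj S * U * dg n x * adj U * S * V * dg m y) = (adj M * dg n x) * (M * dg m y)"
    by (simp add: M_def assoc_dim D adj_mult)
  also have "mtrace \<dots> = (\<Sum>j<m. \<Sum>i<n. (adj M * dg n x) $$ (j,i) * (M * dg m y) $$ (i,j))"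
    unfolding mtrace_def by (simp add: dM mult_idx del: index_mult_mat(1))
  also have "\<dots> = (\<Sum>j<m. \<Sum>i<n. complex_of_real (x i * y j * (cmod (M $$ (i,j)))\<^sup>2))"
    by (intro sum.cong refl)
      (auto simp: dM mult_dg_idx complex_norm_square simp del: index_mult_mat(1) of_real_power)
  also have "\<dots> = (\<Sum>i<n. \<Sum>j<m. complex_of_real (x i * y j * (cmod (M $$ (i,j)))\<^sup>2))"
    by (rule sum.swap)
  finally show ?thesis by (simp add: M_def)
qed

lemma mtrace_congr_nonneg:
  assumes X: "pos_def n X" and Y: "pos_def m Y" and S: "dim_row S = n" "dim_col S = m"
  shows "0 \<le> Re (mtrace (adj S * X * S * Y))"
proof -
  obtain U x where e: "eig n X U x" "\<And>i. i < n \<Longrightarrow> 0 < x i" using pos_def_eig[OF X] by blast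
  obtain V y where f: "eig m Y V y" "\<And>i. i < m \<Longrightarrow> 0 < y i" using pos_def_eig[OF Y] by blast
  show ?thesis
    unfolding mtrace_eig_eig[OF e(1) f(1) S]
    using e(2) f(2) by (intro sum_nonneg mult_nonneg_nonneg) (auto simp: less_imp_le)
qed

lemma unitary_sums:
  assumes "unitary n M"
  shows "i < n \<Longrightarrow> (\<Sum>j<n. (cmod (M $$ (i,j)))\<^sup>2) = 1" "j < n \<Longrightarrow> (\<Sum>i<n. (cmod (M $$ (i,j)))\<^sup>2) = 1"
proof -
  note D = unitary_dim[OF assms]
  { assume i: "i < n"
    have "complex_of_real (\<Sum>j<n. (cmod (M $$ (i,j)))\<^sup>2) = (M * adj M) $$ (i,i)"
      using i by (subst mult_idx) (auto simp: D complex_norm_square simp del: of_real_power)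
    also have "\<dots> = 1" using i by (simp add: unitary_right[OF assms])
    finally show "(\<Sum>j<n. (cmod (M $$ (i,j)))\<^sup>2) = 1" by (simp only: of_real_eq_1_iff) }
  { assume j: "j < n"
    have "complex_of_real (\<Sum>i<n. (cmod (M $$ (i,j)))\<^sup>2) = (adj M * M) $$ (j,j)"
      using j by (subst mult_idx) (auto simp: D complex_norm_square mult.commute simp del: of_real_power)
    also have "\<dots> = 1" using j by (simp add: unitary_left[OF assms])
    finally show "(\<Sum>i<n. (cmod (M $$ (i,j)))\<^sup>2) = 1" by (simp only: of_real_eq_1_iff) }
qed

text \<open>A scalar inequality that is affine in each eigenvalue function passes to traces: the squared
  overlaps of the two eigenbases form a doubly stochastic matrix.\<close>

lemma klein_inequality:
  assumes X: "pos_def n X" and Y: "pos_def n Y"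
    and ineq: "\<And>x y. 0 < x \<Longrightarrow> 0 < y \<Longrightarrow> 0 \<le> a x + b x * c y + d y"
  shows "0 \<le> Re (mtrace (mfun a X)) + Re (mtrace (mfun b X * mfun c Y)) + Re (mtrace (mfun d Y))"
proof -
  obtain U x where e: "eig n X U x" "\<And>i. i < n \<Longrightarrow> 0 < x i" using pos_def_eig[OF X] by blast
  obtain V y where f: "eig n Y V y" "\<And>i. i < n \<Longrightarrow> 0 < y i" using pos_def_eig[OF Y] by blast
  note D = eig_dim[OF e(1)] eig_dim[OF f(1)] mfun_dim[OF X] mfun_dim[OF Y]
  define w where "w i j = (cmod ((adj U * 1\<^sub>m n * V) $$ (i,j)))\<^sup>2" for i j
  have "unitary n (adj U * 1\<^sub>m n * V)"
    using e(1) f(1) by (intro unitary_mult unitary_adj unitary_one) (auto simp: eig_def)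
  note s = unitary_sums[OF this, folded w_def]
  have w0: "0 \<le> w i j" for i j by (simp add: w_def)
  have "Re (mtrace (mfun a X)) = (\<Sum>i<n. a (x i))"
    by (simp add: mtrace_eig[OF eig_mfun_eig[OF e(1)]])
  also have "\<dots> = (\<Sum>i<n. \<Sum>j<n. a (x i) * w i j)"
    by (simp flip: sum_distrib_left add: s)
  finally have 1: "Re (mtrace (mfun a X)) = (\<Sum>i<n. \<Sum>j<n. a (x i) * w i j)" .
  have "Re (mtrace (mfun d Y)) = (\<Sum>j<n. d (y j))"
    by (simp add: mtrace_eig[OF eig_mfun_eig[OF f(1)]])
  also have "\<dots> = (\<Sum>j<n. \<Sum>i<n. d (y j) * w i j)"
    by (simp flip: sum_distrib_left add: s)
  also have "\<dots> = (\<Sum>i<n. \<Sum>j<n. d (y j) * w i j)" by (rule sum.swap)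
  finally have 2: "Re (mtrace (mfun d Y)) = (\<Sum>i<n. \<Sum>j<n. d (y j) * w i j)" .
  have "mfun b X * mfun c Y = adj (1\<^sub>m n) * mfun b X * 1\<^sub>m n * mfun c Y"
    by (simp add: mult_one_dim D)
  hence 3: "Re (mtrace (mfun b X * mfun c Y)) = (\<Sum>i<n. \<Sum>j<n. b (x i) * c (y j) * w i j)"
    unfolding w_def by (simp only: mtrace_eig_eig[OF eig_mfun_eig[OF e(1)] eig_mfun_eig[OF f(1)] index_one_mat(2,3)])
  have "0 \<le> (\<Sum>i<n. \<Sum>j<n. (a (x i) + b (x i) * c (y j) + d (y j)) * w i j)"
    using ineq e(2) f(2) w0 by (intro sum_nonneg mult_nonneg_nonneg) auto
  also have "\<dots> = (\<Sum>i<n. \<Sum>j<n. a (x i) * w i j) + (\<Sum>i<n. \<Sum>j<n. b (x i) * c (y j) * w i j)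
      + (\<Sum>i<n. \<Sum>j<n. d (y j) * w i j)"
    by (simp add: distrib_right sum.distrib)
  finally show ?thesis by (simp only: 1 2 3)
qed

section \<open>Lieb concavity\<close>

definition mix :: "real \<Rightarrow> complex mat \<Rightarrow> complex mat \<Rightarrow> complex mat" where
  "mix t A B = complex_of_real t \<cdot>\<^sub>m A + complex_of_real (1 - t) \<cdot>\<^sub>m B"

lemma mix_dim [simp]: "dim_row (mix t A B) = dim_row B" "dim_col (mix t A B) = dim_col B"
  by (simp_all add: mix_def)

lemma pos_def_mix:
  assumes A: "pos_def n A" and B: "pos_def n B" and t: "0 \<le> t" "t \<le> 1"
  shows "pos_def n (mix t A B)"
  unfolding pos_def_def
proof (intro conjI ballI impI)
  note D = pos_defD[OF A] pos_defD[OF B]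
  show "mix t A B \<in> carrier_mat n n" by (rule carrier_matI) (simp_all add: D)
  show "adj (mix t A B) = mix t A B"
    by (simp add: mix_def adj_add adj_smult D)
  fix v :: "complex vec" assume v: "v \<in> carrier_vec n" "v \<noteq> 0\<^sub>v n"
  have "(mix t A B *\<^sub>v v) $ i = complex_of_real t * (A *\<^sub>v v) $ i + complex_of_real (1 - t) * (B *\<^sub>v v) $ i"
    if "i < n" for i
    using that D v
    by (simp add: mix_def scalar_prod_def sum_distrib_left distrib_right sum.distrib mult.assoc)
  hence "herm_form (mix t A B) v = complex_of_real t * herm_form A v + complex_of_real (1 - t) * herm_form B v"
    using v D by (simp add: herm_form_def sum_distrib_left distrib_left sum.distrib mult.left_commute)
  hence "Re (herm_form (mix t A B) v) = t * Re (herm_form A v) + (1 - t) * Re (herm_form B v)" by simp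
  moreover have "0 < Re (herm_form A v)" "0 < Re (herm_form B v)" using A B v by (auto simp: pos_def_def)
  ultimately show "0 < Re (herm_form (mix t A B) v)"
    using t by (cases "t = 0") (auto intro!: add_pos_nonneg)
qed

lemma mtrace_mix:
  assumes "dim_col L = n" "dim_row A = n" "dim_row B = n" "dim_col A = m" "dim_col B = m"
    "dim_row R = m" "dim_row L = k" "dim_col R = k"
  shows "Re (mtrace (L * mix t A B * R)) = t * Re (mtrace (L * A * R)) + (1 - t) * Re (mtrace (L * B * R))"
proof -
  have "L * mix t A B * R = complex_of_real t \<cdot>\<^sub>m (L * A * R) + complex_of_real (1 - t) \<cdot>\<^sub>m (L * B * R)"
    unfolding mix_def using assms by (simp add: mult_add_dim add_mult_dim smult_mult_dim)
  thus ?thesis using assms by (simp add: mtrace_add mtrace_smult)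
qed

text \<open>After the triangle inequality and multiplication by \<alpha> + \<beta>, the gap is the
  square of \<alpha> |z| - \<beta> |w|. Equality holds when \<alpha> z = \<beta> w.\<close>

lemma parallel_sum_scalar:
  assumes "0 < (\<alpha>::real)" "0 < \<beta>"
  shows "\<alpha> * \<beta> / (\<alpha> + \<beta>) * (cmod (z + w))\<^sup>2 \<le> \<alpha> * (cmod z)\<^sup>2 + \<beta> * (cmod w)\<^sup>2"
proof -
  have "\<alpha> * \<beta> * (cmod (z + w))\<^sup>2 \<le> \<alpha> * \<beta> * (cmod z + cmod w)\<^sup>2"
    using assms by (intro mult_left_mono power_mono norm_triangle_ineq) auto
  also have "\<dots> \<le> \<alpha> * \<beta> * (cmod z + cmod w)\<^sup>2 + (\<alpha> * cmod z - \<beta> * cmod w)\<^sup>2" by simp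
  also have "\<dots> = (\<alpha> * (cmod z)\<^sup>2 + \<beta> * (cmod w)\<^sup>2) * (\<alpha> + \<beta>)"
    by (simp add: power2_eq_square algebra_simps)
  finally have "\<alpha> * \<beta> * (cmod (z + w))\<^sup>2 / (\<alpha> + \<beta>) \<le> \<alpha> * (cmod z)\<^sup>2 + \<beta> * (cmod w)\<^sup>2"
    using assms by (subst pos_divide_le_eq) auto
  thus ?thesis by simp
qed

text \<open>The quadratic form at \<open>S\<close> of the parallel sum of two commuting operators on
  n by m matrices: left multiplication by c A and right multiplication by B. In their joint
  eigenbasis the eigenvalues are c a i and b j.\<close>

definition parallel_form :: "nat \<Rightarrow> nat \<Rightarrow> real \<Rightarrow> complex mat \<Rightarrow> (nat \<Rightarrow> real) \<Rightarrow> complex mat \<Rightarrow> (nat \<Rightarrow> real) \<Rightarrow> complex mat \<Rightarrow> real" where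
  "parallel_form n m c U a V b S =
    (\<Sum>i<n. \<Sum>j<m. (c * a i * b j / (c * a i + b j)) * (cmod ((adj U * S * V) $$ (i,j)))\<^sup>2)"

text \<open>The scalar inequality is applied entry by entry. The identity factors bring both traces
  into the shape of \<open>mtrace_eig_eig\<close>, so that both expand in the same pair of
  bases.\<close>

lemma parallel_form_le:
  assumes A: "eig n A U a" "\<And>i. i < n \<Longrightarrow> 0 < a i" and B: "eig m B V b" "\<And>i. i < m \<Longrightarrow> 0 < b i"
    and c: "0 < c" and S: "dim_row S1 = n" "dim_col S1 = m" "dim_row S2 = n" "dim_col S2 = m"
  shows "parallel_form n m c U a V b (S1 + S2) \<le>
    c * Re (mtrace (adj S1 * A * S1 * 1\<^sub>m m)) + Re (mtrace (adj S2 * 1\<^sub>m n * S2 * B))"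
proof -
  note D = eig_dim[OF A(1)] eig_dim[OF B(1)] S
  have U: "unitary n U" and V: "unitary m V" using A B by (auto simp: eig_def)
  have s: "(adj U * (S1 + S2) * V) = adj U * S1 * V + adj U * S2 * V"
    by (simp add: mult_add_dim add_mult_dim D)
  have "parallel_form n m c U a V b (S1 + S2) \<le> (\<Sum>i<n. \<Sum>j<m.
     c * a i * (cmod ((adj U * S1 * V) $$ (i,j)))\<^sup>2 + b j * (cmod ((adj U * S2 * V) $$ (i,j)))\<^sup>2)"
    unfolding parallel_form_def
  proof (intro sum_mono)
    fix i j assume "i \<in> {..<n}" "j \<in> {..<m}"
    hence i: "i < n" and j: "j < m" by auto
    have "(adj U * (S1 + S2) * V) $$ (i,j) = (adj U * S1 * V) $$ (i,j) + (adj U * S2 * V) $$ (i,j)"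
      unfolding s by (rule index_add_mat(1)) (simp_all add: D i j)
    thus "c * a i * b j / (c * a i + b j) * (cmod ((adj U * (S1 + S2) * V) $$ (i,j)))\<^sup>2 \<le>
      c * a i * (cmod ((adj U * S1 * V) $$ (i,j)))\<^sup>2 + b j * (cmod ((adj U * S2 * V) $$ (i,j)))\<^sup>2"
      using parallel_sum_scalar[of "c * a i" "b j"] A(2)[OF i] B(2)[OF j] c by simp
  qed
  also have "\<dots> = c * Re (mtrace (adj S1 * A * S1 * 1\<^sub>m m)) + Re (mtrace (adj S2 * 1\<^sub>m n * S2 * B))"
    unfolding mtrace_eig_eig[OF A(1) eig_one[OF V] S(1,2)] mtrace_eig_eig[OF eig_one[OF U] B(1) S(3,4)]
    by (simp add: sum.distrib sum_distrib_left mult.assoc)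
  finally show ?thesis .
qed

lemma parallel_form_eq:
  assumes A: "eig n A U a" "\<And>i. i < n \<Longrightarrow> 0 < a i" and B: "eig m B V b" "\<And>i. i < m \<Longrightarrow> 0 < b i"
    and c: "0 < c" and S: "dim_row S = n" "dim_col S = m"
  obtains S1 S2 where "dim_row S1 = n" "dim_col S1 = m" "dim_row S2 = n" "dim_col S2 = m" "S = S1 + S2"
    "parallel_form n m c U a V b S =
      c * Re (mtrace (adj S1 * A * S1 * 1\<^sub>m m)) + Re (mtrace (adj S2 * 1\<^sub>m n * S2 * B))"
proof -
  note D = eig_dim[OF A(1)] eig_dim[OF B(1)] S
  have U: "unitary n U" and V: "unitary m V" using A B by (auto simp: eig_def)
  define M where "M = adj U * S * V"
  have dM: "dim_row M = n" "dim_col M = m" by (simp_all add: M_def D)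
  \<comment> \<open>The optimal splitting: each entry of \<open>M\<close> is divided in the ratio b
    j to c a i, which is the case of equality in \<open>parallel_sum_scalar\<close>.\<close>
  define M1 where "M1 = mat n m (\<lambda>(i,j). complex_of_real (b j / (c * a i + b j)) * M $$ (i,j))"
  define M2 where "M2 = mat n m (\<lambda>(i,j). complex_of_real (c * a i / (c * a i + b j)) * M $$ (i,j))"
  have d12: "dim_row M1 = n" "dim_col M1 = m" "dim_row M2 = n" "dim_col M2 = m"
    by (simp_all add: M1_def M2_def)
  define S1 where "S1 = U * M1 * adj V"
  define S2 where "S2 = U * M2 * adj V"
  have dS: "dim_row S1 = n" "dim_col S1 = m" "dim_row S2 = n" "dim_col S2 = m"
    by (simp_all add: S1_def S2_def D d12)
  have pos: "0 < c * a i + b j" if "i < n" "j < m" for i j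
    using A(2)[of i] B(2)[of j] c that by (simp add: add_pos_pos)
  have "M = M1 + M2"
  proof (rule eq_matI)
    fix i j assume "i < dim_row (M1 + M2)" "j < dim_col (M1 + M2)"
    hence i: "i < n" and j: "j < m" by (auto simp: d12)
    have "b j / (c * a i + b j) + c * a i / (c * a i + b j) = 1"
      using pos[OF i j] by (simp flip: add_divide_distrib)
    hence "complex_of_real (b j / (c * a i + b j)) + complex_of_real (c * a i / (c * a i + b j)) = 1"
      by (simp only: of_real_add[symmetric] of_real_1)
    hence "complex_of_real (b j / (c * a i + b j)) * M $$ (i,j) + complex_of_real (c * a i / (c * a i + b j)) * M $$ (i,j) = M $$ (i,j)"
      by (simp only: distrib_right[symmetric] mult_1)
    thus "M $$ (i,j) = (M1 + M2) $$ (i,j)" using i j by (simp add: M1_def M2_def)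
  qed (simp_all add: d12 dM)
  hence "S1 + S2 = U * M * adj V"
    by (simp add: S1_def S2_def mult_add_dim add_mult_dim D d12)
  also have "\<dots> = S"
    by (simp add: M_def assoc_dim D unitary_right[OF V] mult_one_dim mult_cancel_dim[OF unitary_right[OF U]])
  finally have S12: "S = S1 + S2" by simp
  have UV: "adj U * S1 * V = M1" "adj U * S2 * V = M2"
    by (simp_all add: S1_def S2_def assoc_dim D d12 unitary_left[OF V] mult_one_dim mult_cancel_dim[OF unitary_left[OF U]])
  have "c * Re (mtrace (adj S1 * A * S1 * 1\<^sub>m m)) + Re (mtrace (adj S2 * 1\<^sub>m n * S2 * B)) =
    (\<Sum>i<n. \<Sum>j<m. c * a i * (cmod (M1 $$ (i,j)))\<^sup>2 + b j * (cmod (M2 $$ (i,j)))\<^sup>2)"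
    unfolding mtrace_eig_eig[OF A(1) eig_one[OF V] dS(1,2)] mtrace_eig_eig[OF eig_one[OF U] B(1) dS(3,4)] UV
    by (simp add: sum.distrib sum_distrib_left mult.assoc)
  also have "\<dots> = parallel_form n m c U a V b S"
    unfolding parallel_form_def M_def[symmetric]
  proof (intro sum.cong refl)
    fix i j assume "i \<in> {..<n}" "j \<in> {..<m}"
    hence i: "i < n" and j: "j < m" by auto
    define \<alpha> \<beta> where "\<alpha> = c * a i" and "\<beta> = b j"
    have ab: "0 < \<alpha> + \<beta>" using pos[OF i j] by (simp add: \<alpha>_def \<beta>_def)
    have 1: "(cmod (M1 $$ (i,j)))\<^sup>2 = (\<beta> / (\<alpha> + \<beta>))\<^sup>2 * (cmod (M $$ (i,j)))\<^sup>2"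
      using i j by (simp add: M1_def \<alpha>_def \<beta>_def norm_mult power_mult_distrib norm_divide power_divide del: of_real_add of_real_mult)
    have 2: "(cmod (M2 $$ (i,j)))\<^sup>2 = (\<alpha> / (\<alpha> + \<beta>))\<^sup>2 * (cmod (M $$ (i,j)))\<^sup>2"
      using i j by (simp add: M2_def \<alpha>_def \<beta>_def norm_mult power_mult_distrib norm_divide power_divide del: of_real_add of_real_mult)
    have "\<alpha> * (\<beta> / (\<alpha> + \<beta>))\<^sup>2 + \<beta> * (\<alpha> / (\<alpha> + \<beta>))\<^sup>2 = \<alpha> * \<beta> * (\<alpha> + \<beta>) / (\<alpha> + \<beta>)\<^sup>2"
      by (simp add: power_divide add_divide_distrib[symmetric]) (simp add: power2_eq_square algebra_simps)
    also have "\<dots> = \<alpha> * \<beta> / (\<alpha> + \<beta>)" using ab by (simp add: power2_eq_square)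
    finally have "\<alpha> * \<beta> / (\<alpha> + \<beta>) * (cmod (M $$ (i,j)))\<^sup>2 =
        \<alpha> * (\<beta> / (\<alpha> + \<beta>))\<^sup>2 * (cmod (M $$ (i,j)))\<^sup>2 + \<beta> * (\<alpha> / (\<alpha> + \<beta>))\<^sup>2 * (cmod (M $$ (i,j)))\<^sup>2"
      by (simp only: distrib_right[symmetric])
    thus "c * a i * (cmod (M1 $$ (i,j)))\<^sup>2 + b j * (cmod (M2 $$ (i,j)))\<^sup>2
      = c * a i * b j / (c * a i + b j) * (cmod (M $$ (i,j)))\<^sup>2"
      unfolding 1 2 by (simp add: \<alpha>_def \<beta>_def mult.assoc)
  qed
  finally show ?thesis using that dS S12 by simp
qed

text \<open>Being a minimum over \<open>S = S1 + S2\<close> of functionals linear in \<open>(A, B)\<close>, every parallel form is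
  jointly concave; integrating over \<open>c = exp x\<close> gives Lieb's theorem.\<close>

theorem lieb_concavity:
  assumes A1: "pos_def n A1" and A2: "pos_def n A2" and B1: "pos_def m B1" and B2: "pos_def m B2"
    and S: "dim_row S = n" "dim_col S = m" and r: "0 \<le> r" "r < 1" and t: "0 \<le> t" "t \<le> 1"
  shows "t * Re (mtrace (adj S * mpow A1 r * S * mpow B1 (1 - r))) + (1 - t) * Re (mtrace (adj S * mpow A2 r * S * mpow B2 (1 - r)))
    \<le> Re (mtrace (adj S * mpow (mix t A1 A2) r * S * mpow (mix t B1 B2) (1 - r)))"
proof -
  define A where "A = mix t A1 A2"
  define B where "B = mix t B1 B2"
  have A: "pos_def n A" unfolding A_def by (rule pos_def_mix[OF A1 A2 t])
  have B: "pos_def m B" unfolding B_def by (rule pos_def_mix[OF B1 B2 t])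
  note D = pos_defD[OF A1] pos_defD[OF A2] pos_defD[OF B1] pos_defD[OF B2] S
  show ?thesis
  proof (cases "r = 0")
    \<comment> \<open>The integral representation is available for 0 < r. At r = 0 the power of the
      first matrix is the identity and the trace is linear in the second one.\<close>
    case True
    have "mix t B1 B2 = mix t B1 B2 * 1\<^sub>m m" by (simp add: mult_one_dim D)
    hence "Re (mtrace (adj S * S * mix t B1 B2)) = Re (mtrace (adj S * S * mix t B1 B2 * 1\<^sub>m m))"
      by (simp add: assoc_dim D)
    also have "\<dots> = t * Re (mtrace (adj S * S * B1)) + (1 - t) * Re (mtrace (adj S * S * B2))"
      by (subst mtrace_mix[where n = m and m = m and k = m]) (simp_all add: D mult_one_dim)
    finally show ?thesis
      using True by (simp add: mpow_0[OF A1] mpow_0[OF A2] mpow_0[OF A, unfolded A_def]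
          mpow_1[OF B1] mpow_1[OF B2] mpow_1[OF B, unfolded B_def] mult_one_dim D)
  next
    case False
    hence r0: "0 < r" using r by simp
    obtain C where C: "0 < C" and int: "\<And>a u. 0 < a \<Longrightarrow> 0 < u \<Longrightarrow>
      has_bochner_integral lborel (\<lambda>x. exp (-r * x) * (exp x * a * u / (exp x * a + u))) (C * (a powr r * u powr (1 - r)))"
      using powr_mean_integral[OF r0 r(2)] by blast
    have rep: "has_bochner_integral lborel (\<lambda>x. exp (-r * x) * parallel_form n m (exp x) U a V b S)
        (C * Re (mtrace (adj S * mpow X r * S * mpow Y (1 - r))))"
      if X: "eig n X U a" "\<And>i. i < n \<Longrightarrow> 0 < a i" and Y: "eig m Y V b" "\<And>i. i < m \<Longrightarrow> 0 < b i" for X Y U a V b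
    proof -
      let ?w = "\<lambda>i j. (cmod ((adj U * S * V) $$ (i,j)))\<^sup>2"
      have "has_bochner_integral lborel (\<lambda>x. \<Sum>i<n. \<Sum>j<m. exp (-r * x) * (exp x * a i * b j / (exp x * a i + b j)) * ?w i j)
        (\<Sum>i<n. \<Sum>j<m. C * (a i powr r * b j powr (1 - r)) * ?w i j)"
        by (intro has_bochner_integral_sum has_bochner_integral_mult_left int) (use X Y in auto)
      moreover have "(\<Sum>i<n. \<Sum>j<m. exp (-r * x) * (exp x * a i * b j / (exp x * a i + b j)) * ?w i j)
          = exp (-r * x) * parallel_form n m (exp x) U a V b S" for x
        by (simp add: parallel_form_def sum_distrib_left mult.assoc)
      moreover have "(\<Sum>i<n. \<Sum>j<m. C * (a i powr r * b j powr (1 - r)) * ?w i j)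
          = C * Re (mtrace (adj S * mpow X r * S * mpow Y (1 - r)))"
        unfolding mpow_def mtrace_eig_eig[OF eig_mfun_eig[OF X(1)] eig_mfun_eig[OF Y(1)] S]
        by (simp add: sum_distrib_left mult.assoc)
      ultimately show ?thesis by simp
    qed
    obtain U a where eA: "eig n A U a" "\<And>i. i < n \<Longrightarrow> 0 < a i" using pos_def_eig[OF A] by blast
    obtain U1 a1 where eA1: "eig n A1 U1 a1" "\<And>i. i < n \<Longrightarrow> 0 < a1 i" using pos_def_eig[OF A1] by blast
    obtain U2 a2 where eA2: "eig n A2 U2 a2" "\<And>i. i < n \<Longrightarrow> 0 < a2 i" using pos_def_eig[OF A2] by blast
    obtain V b where eB: "eig m B V b" "\<And>i. i < m \<Longrightarrow> 0 < b i" using pos_def_eig[OF B] by blast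
    obtain V1 b1 where eB1: "eig m B1 V1 b1" "\<And>i. i < m \<Longrightarrow> 0 < b1 i" using pos_def_eig[OF B1] by blast
    obtain V2 b2 where eB2: "eig m B2 V2 b2" "\<And>i. i < m \<Longrightarrow> 0 < b2 i" using pos_def_eig[OF B2] by blast
    have pf: "t * parallel_form n m c U1 a1 V1 b1 S + (1 - t) * parallel_form n m c U2 a2 V2 b2 S
        \<le> parallel_form n m c U a V b S" if c: "0 < c" for c
    proof -
      \<comment> \<open>The splitting that is optimal for the mixture is admissible at both
        endpoints, where it bounds the parallel form from above.\<close>
      obtain S1 S2 where s: "dim_row S1 = n" "dim_col S1 = m" "dim_row S2 = n" "dim_col S2 = m" "S = S1 + S2"
        and eq: "parallel_form n m c U a V b S =
          c * Re (mtrace (adj S1 * A * S1 * 1\<^sub>m m)) + Re (mtrace (adj S2 * 1\<^sub>m n * S2 * B))"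
        by (rule parallel_form_eq[OF eA eB c S]) auto
      have m1: "Re (mtrace (adj S1 * A * S1 * 1\<^sub>m m)) = t * Re (mtrace (adj S1 * A1 * S1 * 1\<^sub>m m))
          + (1 - t) * Re (mtrace (adj S1 * A2 * S1 * 1\<^sub>m m))"
        using mtrace_mix[of "adj S1" n A1 A2 n S1 m t] by (simp add: A_def s D mult_one_dim)
      have m2: "Re (mtrace (adj S2 * 1\<^sub>m n * S2 * B)) = t * Re (mtrace (adj S2 * 1\<^sub>m n * S2 * B1))
          + (1 - t) * Re (mtrace (adj S2 * 1\<^sub>m n * S2 * B2))"
        using mtrace_mix[of "adj S2 * 1\<^sub>m n * S2" m B1 B2 m "1\<^sub>m m" m t] by (simp add: B_def s D mult_one_dim)
      have "t * parallel_form n m c U1 a1 V1 b1 S + (1 - t) * parallel_form n m c U2 a2 V2 b2 S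
        \<le> t * (c * Re (mtrace (adj S1 * A1 * S1 * 1\<^sub>m m)) + Re (mtrace (adj S2 * 1\<^sub>m n * S2 * B1)))
        + (1 - t) * (c * Re (mtrace (adj S1 * A2 * S1 * 1\<^sub>m m)) + Re (mtrace (adj S2 * 1\<^sub>m n * S2 * B2)))"
        unfolding s(5) using t
        by (intro add_mono mult_left_mono parallel_form_le[OF eA1 eB1 c s(1-4)] parallel_form_le[OF eA2 eB2 c s(1-4)]) auto
      also have "\<dots> = parallel_form n m c U a V b S"
        unfolding eq m1 m2 by (simp add: algebra_simps)
      finally show ?thesis .
    qed
    let ?L = "\<lambda>X Y. Re (mtrace (adj S * mpow X r * S * mpow Y (1 - r)))"
    note h1 = rep[OF eA1 eB1] and h2 = rep[OF eA2 eB2] and h = rep[OF eA eB]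
    let ?q = "\<lambda>U a V b x. exp (-r * x) * parallel_form n m (exp x) U a V b S"
    have hs: "has_bochner_integral lborel (\<lambda>x. t * ?q U1 a1 V1 b1 x + (1 - t) * ?q U2 a2 V2 b2 x)
        (t * (C * ?L A1 B1) + (1 - t) * (C * ?L A2 B2))"
      by (intro has_bochner_integral_add has_bochner_integral_mult_right h1 h2)
    have "integral\<^sup>L lborel (\<lambda>x. t * ?q U1 a1 V1 b1 x + (1 - t) * ?q U2 a2 V2 b2 x) \<le> integral\<^sup>L lborel (?q U a V b)"
    proof (rule integral_mono[OF integrable.intros[OF hs] integrable.intros[OF h]])
      fix x :: real
      have "exp (-r * x) * (t * parallel_form n m (exp x) U1 a1 V1 b1 S + (1 - t) * parallel_form n m (exp x) U2 a2 V2 b2 S)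
        \<le> exp (-r * x) * parallel_form n m (exp x) U a V b S"
        by (intro mult_left_mono pf) auto
      thus "t * ?q U1 a1 V1 b1 x + (1 - t) * ?q U2 a2 V2 b2 x \<le> ?q U a V b x"
        by (simp add: algebra_simps)
    qed
    hence "t * (C * ?L A1 B1) + (1 - t) * (C * ?L A2 B2) \<le> C * ?L A B"
      using has_bochner_integral_integral_eq[OF hs] has_bochner_integral_integral_eq[OF h] by simp
    hence "C * (t * ?L A1 B1 + (1 - t) * ?L A2 B2) \<le> C * ?L A B" by (simp add: algebra_simps)
    thus ?thesis using C by (simp add: A_def B_def)
  qed
qed

section \<open>Kraus operators\<close>

text \<open>The identity \<Phi>(X) = sum of \<open>adj (K c) * X * K c\<close> in weak form, tested
  against every \<open>M\<close> under the trace, which avoids finite sums of matrices. The adjoint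
  stands on the left, so \<open>K c\<close> has \<open>n\<close> rows.\<close>

definition kraus :: "nat \<Rightarrow> nat \<Rightarrow> (complex mat \<Rightarrow> complex mat) \<Rightarrow> nat \<Rightarrow> (nat \<Rightarrow> complex mat) \<Rightarrow> bool" where
  "kraus n l \<Phi> N K \<longleftrightarrow> (\<forall>c<N. K c \<in> carrier_mat n l) \<and>
    (\<forall>X\<in>carrier_mat n n. \<forall>M\<in>carrier_mat l l. mtrace (\<Phi> X * M) = (\<Sum>c<N. mtrace (adj (K c) * X * K c * M)))"

text \<open>Additivity is given for two summands at a time and inside the carrier, so
  \<open>X\<close> is assembled entry by entry; \<open>R I\<close> keeps the entries with index in
  \<open>I\<close>.\<close>

lemma lin_map_expand:
  assumes lin: "lin_map n l \<Phi>" and X: "X \<in> carrier_mat n n" and pq: "p < l" "q < l"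
  shows "\<Phi> X $$ (p,q) = (\<Sum>(a,b)\<in>{..<n}\<times>{..<n}. X $$ (a,b) *
    \<Phi> (mat n n (\<lambda>(i,j). if i = a \<and> j = b then 1 else 0)) $$ (p,q))"
proof -
  define E :: "nat \<Rightarrow> nat \<Rightarrow> complex mat" where "E a b = mat n n (\<lambda>(i,j). if i = a \<and> j = b then 1 else 0)" for a b
  define R where "R I = mat n n (\<lambda>(i,j). if (i,j) \<in> I then X $$ (i,j) else 0)" for I
  have cE: "E a b \<in> carrier_mat n n" for a b by (simp add: E_def)
  have cR: "R I \<in> carrier_mat n n" for I by (simp add: R_def)
  have c\<Phi>: "\<Phi> Y \<in> carrier_mat l l" if "Y \<in> carrier_mat n n" for Y using lin that by (simp add: lin_map_def)
  have add: "\<Phi> (Y + Z) = \<Phi> Y + \<Phi> Z" if "Y \<in> carrier_mat n n" "Z \<in> carrier_mat n n" for Y Z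
    using lin that by (simp add: lin_map_def)
  have smult: "\<Phi> (c \<cdot>\<^sub>m Y) = c \<cdot>\<^sub>m \<Phi> Y" if "Y \<in> carrier_mat n n" for c Y using lin that by (simp add: lin_map_def)
  have "\<Phi> (R I) $$ (p,q) = (\<Sum>(a,b)\<in>I. X $$ (a,b) * \<Phi> (E a b) $$ (p,q))"
    if "finite I" "I \<subseteq> {..<n}\<times>{..<n}" for I
    using that
  proof (induction I rule: finite_induct)
    case empty
    have "R {} = 0 \<cdot>\<^sub>m R {}" by (rule eq_matI) (auto simp: R_def)
    hence "\<Phi> (R {}) = 0 \<cdot>\<^sub>m \<Phi> (R {})" using smult[OF cR] by metis
    hence "\<Phi> (R {}) $$ (p,q) = (0 \<cdot>\<^sub>m \<Phi> (R {})) $$ (p,q)" by simp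
    also have "\<dots> = 0" using c\<Phi>[OF cR, of "{}"] pq by auto
    finally show ?case by simp
  next
    case (insert x I)
    obtain a b where x: "x = (a,b)" by (cases x)
    have "R (insert x I) = R I + X $$ (a,b) \<cdot>\<^sub>m E a b"
      by (rule eq_matI) (use insert.hyps x in \<open>auto simp: R_def E_def\<close>)
    hence "\<Phi> (R (insert x I)) = \<Phi> (R I) + X $$ (a,b) \<cdot>\<^sub>m \<Phi> (E a b)"
      using add[OF cR, of "X $$ (a,b) \<cdot>\<^sub>m E a b"] smult[OF cE] cE by simp
    hence "\<Phi> (R (insert x I)) $$ (p,q) = \<Phi> (R I) $$ (p,q) + X $$ (a,b) * \<Phi> (E a b) $$ (p,q)"
      using c\<Phi>[OF cE, of a b] pq by auto
    thus ?case using insert x by simp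
  qed
  from this[of "{..<n}\<times>{..<n}"] have "\<Phi> (R ({..<n}\<times>{..<n})) $$ (p,q) = (\<Sum>(a,b)\<in>{..<n}\<times>{..<n}. X $$ (a,b) * \<Phi> (E a b) $$ (p,q))"
    by simp
  moreover have "R ({..<n}\<times>{..<n}) = X" by (rule eq_matI) (use X in \<open>auto simp: R_def\<close>)
  ultimately show ?thesis by (simp add: E_def)
qed

lemma pos_semidef_rank_one:
  fixes w :: "nat \<Rightarrow> real"
  shows "pos_semidef n (mat n n (\<lambda>(i,j). complex_of_real (w i * w j)))"
  unfolding pos_semidef_def
proof (intro conjI ballI)
  let ?M = "mat n n (\<lambda>(i,j). complex_of_real (w i * w j))"
  show "adj ?M = ?M" by (rule eq_matI) (auto simp: mult.commute)
  fix v :: "complex vec" assume v: "v \<in> carrier_vec n"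
  define z where "z = (\<Sum>j<n. complex_of_real (w j) * v $ j)"
  have "(?M *\<^sub>v v) $ i = complex_of_real (w i) * z" if "i < n" for i
    using that v by (simp add: scalar_prod_def z_def lessThan_atLeast0 sum_distrib_left mult.assoc)
  hence "herm_form ?M v = (\<Sum>i<n. cnj (v $ i) * (complex_of_real (w i) * z))"
    using v by (simp add: herm_form_def)
  also have "\<dots> = (\<Sum>i<n. complex_of_real (w i) * cnj (v $ i)) * z"
    unfolding sum_distrib_right by (simp add: mult_ac)
  also have "\<dots> = cnj z * z" by (simp add: z_def)
  also have "\<dots> = complex_of_real ((cmod z)\<^sup>2)" by (simp add: complex_norm_square mult.commute del: of_real_power)
  finally show "0 \<le> Re (herm_form ?M v)" by (simp del: of_real_power)
qed simp

text \<open>Choi: a spectral decomposition of the Choi matrix \<open>[\<Phi>(E a b)]\<close>, which is the image of the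
  rank-one matrix \<open>[E a b]\<close>, yields the Kraus operators.\<close>

lemma kraus_exists:
  assumes lin: "lin_map n l \<Phi>" and cp: "completely_positive n l \<Phi>"
  obtains N K where "kraus n l \<Phi> N K"
proof -
  \<comment> \<open>The flattened identity matrix: index \<open>i\<close> stands for the pair (i div
    n, i mod n). The blocks of its rank-one matrix are the matrix units, so complete positivity is
    used with k = n.\<close>
  define w :: "nat \<Rightarrow> real" where "w i = (if i div n = i mod n then 1 else 0)" for i
  define M0 where "M0 = mat (n * n) (n * n) (\<lambda>(i,j). complex_of_real (w i * w j))"
  define E :: "nat \<Rightarrow> nat \<Rightarrow> complex mat" where "E a b = mat n n (\<lambda>(i,j). if i = a \<and> j = b then 1 else 0)" for a b
  have idx: "a * k + i < n * k" if "a < n" "i < k" for a i k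
  proof -
    have "a * k + i < Suc a * k" using that by simp
    also have "\<dots> \<le> n * k" using that by (intro mult_le_mono1) simp
    finally show ?thesis .
  qed
  have blk: "block n M0 a b = E a b" if "a < n" "b < n" for a b
    unfolding block_def E_def
    by (rule eq_matI) (use that idx in \<open>auto simp: M0_def w_def\<close>)
  define C where "C = mat (n * l) (n * l) (\<lambda>(i,j). \<Phi> (block n M0 (i div l) (j div l)) $$ (i mod l, j mod l))"
  have "pos_semidef (n * l) C"
    unfolding C_def M0_def using cp pos_semidef_rank_one by (simp add: completely_positive_def)
  then obtain U d where e: "eig (n * l) C U d" "\<And>i. i < n * l \<Longrightarrow> 0 \<le> d i"
    using pos_semidef_eig by blast
  note D = eig_dim[OF e(1)]
  \<comment> \<open>Column \<open>c\<close> of \<open>U\<close>, scaled by the root of its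
    eigenvalue and reshaped to n by l. The conjugation puts the adjoint on the left factor, as
    \<open>kraus\<close> prescribes.\<close>
  define K where "K c = mat n l (\<lambda>(b,j). complex_of_real (sqrt (d c)) * cnj (U $$ (b * l + j, c)))" for c
  have dK: "dim_row (K c) = n" "dim_col (K c) = l" for c by (simp_all add: K_def)
  have cE: "E a b \<in> carrier_mat n n" for a b by (simp add: E_def)
  have \<Phi>E: "\<Phi> (E a b) $$ (i,j) = (\<Sum>c<n * l. cnj (K c $$ (a,i)) * K c $$ (b,j))"
    if ab: "a < n" "b < n" and ij: "i < l" "j < l" for a b i j
  proof -
    have "\<Phi> (E a b) $$ (i,j) = C $$ (a * l + i, b * l + j)"
      using ab ij idx by (simp add: C_def blk)
    also have "\<dots> = (\<Sum>c<n * l. U $$ (a * l + i, c) * complex_of_real (d c) * cnj (U $$ (b * l + j, c)))"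
      using e(1) D idx ab ij by (simp add: eig_def del: index_mult_mat) (subst conj_dg_idx, auto)
    also have "\<dots> = (\<Sum>c<n * l. cnj (K c $$ (a,i)) * K c $$ (b,j))"
    proof (rule sum.cong[OF refl])
      fix c assume "c \<in> {..<n * l}"
      hence "complex_of_real (sqrt (d c)) * complex_of_real (sqrt (d c)) = complex_of_real (d c)"
        using e(2)[of c] by (simp flip: of_real_mult)
      thus "U $$ (a * l + i, c) * complex_of_real (d c) * cnj (U $$ (b * l + j, c)) = cnj (K c $$ (a,i)) * K c $$ (b,j)"
        using ab ij by (simp add: K_def mult_ac)
    qed
    finally show ?thesis .
  qed
  have "kraus n l \<Phi> (n * l) K"
    unfolding kraus_def
  proof (intro conjI allI impI ballI)
    fix X M :: "complex mat" assume X: "X \<in> carrier_mat n n" and M: "M \<in> carrier_mat l l"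
    have dX: "dim_row X = n" "dim_col X = n" "dim_row M = l" "dim_col M = l" using X M by auto
    have d\<Phi>: "dim_row (\<Phi> X) = l" "dim_col (\<Phi> X) = l" using lin X by (auto simp: lin_map_def)
    have \<Phi>X: "\<Phi> X $$ (i,j) = (\<Sum>c<n * l. (adj (K c) * X * K c) $$ (i,j))" if ij: "i < l" "j < l" for i j
    proof -
      have "\<Phi> X $$ (i,j) = (\<Sum>a<n. \<Sum>b<n. X $$ (a,b) * (\<Sum>c<n * l. cnj (K c $$ (a,i)) * K c $$ (b,j)))"
        unfolding lin_map_expand[OF lin X ij] sum.cartesian_product[symmetric] E_def[symmetric]
        by (intro sum.cong refl) (use ij in \<open>auto simp: \<Phi>E\<close>)
      also have "\<dots> = (\<Sum>a<n. \<Sum>c<n * l. \<Sum>b<n. cnj (K c $$ (a,i)) * X $$ (a,b) * K c $$ (b,j))"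
        by (rule sum.cong[OF refl], subst sum.swap) (simp add: sum_distrib_left mult_ac)
      also have "\<dots> = (\<Sum>c<n * l. \<Sum>a<n. \<Sum>b<n. cnj (K c $$ (a,i)) * X $$ (a,b) * K c $$ (b,j))"
        by (rule sum.swap)
      also have "\<dots> = (\<Sum>c<n * l. (adj (K c) * X * K c) $$ (i,j))"
      proof (rule sum.cong[OF refl])
        fix c
        have "(adj (K c) * X * K c) $$ (i,j) = (\<Sum>b<n. (\<Sum>a<n. cnj (K c $$ (a,i)) * X $$ (a,b)) * K c $$ (b,j))"
          using ij by (simp add: mult_idx dX dK del: index_mult_mat(1))
        also have "\<dots> = (\<Sum>a<n. \<Sum>b<n. cnj (K c $$ (a,i)) * X $$ (a,b) * K c $$ (b,j))"
          unfolding sum_distrib_right by (rule sum.swap)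
        finally show "(\<Sum>a<n. \<Sum>b<n. cnj (K c $$ (a,i)) * X $$ (a,b) * K c $$ (b,j)) = (adj (K c) * X * K c) $$ (i,j)" by simp
      qed
      finally show ?thesis .
    qed
    have "mtrace (\<Phi> X * M) = (\<Sum>i<l. \<Sum>j<l. \<Phi> X $$ (i,j) * M $$ (j,i))"
      by (simp add: mtrace_def mult_idx dX d\<Phi> del: index_mult_mat(1))
    also have "\<dots> = (\<Sum>i<l. \<Sum>j<l. \<Sum>c<n * l. (adj (K c) * X * K c) $$ (i,j) * M $$ (j,i))"
      by (intro sum.cong refl) (simp add: \<Phi>X sum_distrib_right del: index_mult_mat(1))
    also have "\<dots> = (\<Sum>i<l. \<Sum>c<n * l. \<Sum>j<l. (adj (K c) * X * K c) $$ (i,j) * M $$ (j,i))"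
      by (rule sum.cong[OF refl], rule sum.swap)
    also have "\<dots> = (\<Sum>c<n * l. \<Sum>i<l. \<Sum>j<l. (adj (K c) * X * K c) $$ (i,j) * M $$ (j,i))"
      by (rule sum.swap)
    also have "\<dots> = (\<Sum>c<n * l. mtrace (adj (K c) * X * K c * M))"
    proof (rule sum.cong[OF refl])
      fix c
      have dKX: "dim_row (adj (K c) * X * K c) = l" "dim_col (adj (K c) * X * K c) = l" by (simp_all add: dK)
      show "(\<Sum>i<l. \<Sum>j<l. (adj (K c) * X * K c) $$ (i,j) * M $$ (j,i)) = mtrace (adj (K c) * X * K c * M)"
        unfolding mtrace_def using dKX dX by (simp add: mult_idx[of "adj (K c) * X * K c" M] del: index_mult_mat(1))
    qed
    finally show "mtrace (\<Phi> X * M) = (\<Sum>c<n * l. mtrace (adj (K c) * X * K c * M))" .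
  qed (simp add: K_def)
  thus ?thesis by (rule that)
qed

section \<open>Trace functions and polarised quadratic trace forms\<close>

lemma mtrace_mfun_add:
  assumes "pos_def n A"
  shows "Re (mtrace (mfun (\<lambda>x. f x + c * g x) A)) = Re (mtrace (mfun f A)) + c * Re (mtrace (mfun g A))"
proof -
  obtain U d where e: "eig n A U d" using pos_def_eig[OF assms] by blast
  show ?thesis by (simp add: mtrace_eig[OF eig_mfun_eig[OF e]] sum.distrib sum_distrib_left)
qed

lemma mtrace_mfun_mono:
  assumes "pos_def n A" "\<And>x. 0 < x \<Longrightarrow> f x \<le> g x"
  shows "Re (mtrace (mfun f A)) \<le> Re (mtrace (mfun g A))"
proof -
  obtain U d where e: "eig n A U d" "\<And>i. i < n \<Longrightarrow> 0 < d i" using pos_def_eig[OF assms(1)] by blast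
  show ?thesis using e(2) assms(2) by (auto simp: mtrace_eig[OF eig_mfun_eig[OF e(1)]] intro!: sum_mono)
qed

text \<open>The tangent inequality of \<open>k\<close> at the spectrum of the mixture passes to
  traces by Klein's inequality, although the matrices need not commute. Averaging it over
  \<open>A\<close> and \<open>B\<close> cancels the linear terms.\<close>

lemma mtrace_mfun_convex:
  assumes k: "convex_on {0<..} k" and A: "pos_def n A" and B: "pos_def n B" and t: "0 \<le> t" "t \<le> 1"
  shows "Re (mtrace (mfun k (mix t A B))) \<le> t * Re (mtrace (mfun k A)) + (1 - t) * Re (mtrace (mfun k B))"
proof -
  define M where "M = mix t A B"
  have M: "pos_def n M" unfolding M_def by (rule pos_def_mix[OF A B t])
  have "\<exists>d. \<forall>y>0. k x + d * (y - x) \<le> k y" if "0 < x" for x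
    using convex_on_subgradient[OF k that] by metis
  then obtain c where c: "\<And>x y. 0 < x \<Longrightarrow> 0 < y \<Longrightarrow> k x + c x * (y - x) \<le> k y" by metis
  have kl: "0 \<le> Re (mtrace (mfun (\<lambda>x. c x * x + (-1) * k x) M)) + Re (mtrace (mfun (\<lambda>x. - c x) M * Y)) + Re (mtrace (mfun k Y))"
    if Y: "pos_def n Y" for Y
    using klein_inequality[OF M Y, of "\<lambda>x. c x * x + (-1) * k x" "\<lambda>x. - c x" "\<lambda>y. y" k] c
    by (simp add: mfun_ident[OF Y] algebra_simps)
  let ?q = "\<lambda>Y. Re (mtrace (mfun (\<lambda>x. - c x) M * Y))"
  note D = pos_defD[OF A] pos_defD[OF B] pos_defD[OF M] mfun_dim[OF M]
  have "?q M = t * ?q A + (1 - t) * ?q B"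
    using mtrace_mix[of "mfun (\<lambda>x. - c x) M" n A B n "1\<^sub>m n" n t]
    by (simp add: D mult_one_dim M_def[symmetric])
  moreover have "mfun (\<lambda>x. - c x) M * M = mfun (\<lambda>x. - c x * x) M"
    using mfun_mult[OF M, of "\<lambda>x. - c x" "\<lambda>x. x"] by (simp add: mfun_ident[OF M])
  moreover have "Re (mtrace (mfun (\<lambda>x. - c x * x) M)) = - Re (mtrace (mfun (\<lambda>x. c x * x) M))"
    using mtrace_mfun_add[OF M, of "\<lambda>x. 0" "-1" "\<lambda>x. c x * x"] mtrace_mfun_add[OF M, of "\<lambda>x. 0" "-1" "\<lambda>x. 0"] by simp
  moreover have "0 \<le> t * (Re (mtrace (mfun (\<lambda>x. c x * x + (-1) * k x) M)) + ?q A + Re (mtrace (mfun k A)))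
     + (1 - t) * (Re (mtrace (mfun (\<lambda>x. c x * x + (-1) * k x) M)) + ?q B + Re (mtrace (mfun k B)))"
    by (rule add_nonneg_nonneg[OF mult_nonneg_nonneg[OF _ kl[OF A]] mult_nonneg_nonneg[OF _ kl[OF B]]]) (use t in auto)
  ultimately show ?thesis
    unfolding M_def[symmetric] mtrace_mfun_add[OF M] by (simp add: algebra_simps)
qed

text \<open>Nonnegativity of the form at Y - Z; the two cross terms are complex conjugates, so their
  real parts agree. Read backwards, the form at \<open>Z\<close> dominates expressions that are
  linear in \<open>X\<close>, with equality at Y = Z.\<close>

lemma mtrace_square_expand:
  assumes X: "pos_def n X" and H: "pos_def m H" and Y: "dim_row Y = n" "dim_col Y = m" and Z: "dim_row Z = n" "dim_col Z = m"
  shows "2 * Re (mtrace (adj Y * X * Z * H)) \<le> Re (mtrace (adj Y * X * Y * H)) + Re (mtrace (adj Z * X * Z * H))"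
proof -
  note D = pos_defD[OF X] pos_defD[OF H] Y Z
  have "mtrace (adj Z * X * Y * H) = mtrace (adj (H * adj Y * X * Z))"
    by (simp add: adj_mult assoc_dim D)
  also have "\<dots> = cnj (mtrace (H * adj Y * X * Z))" by (rule mtrace_adj) (simp add: D)
  also have "mtrace (H * adj Y * X * Z) = mtrace (H * (adj Y * X * Z))" by (simp add: assoc_dim D)
  also have "\<dots> = mtrace (adj Y * X * Z * H)" by (rule mtrace_mult_comm) (simp_all add: D)
  finally have sym: "Re (mtrace (adj Z * X * Y * H)) = Re (mtrace (adj Y * X * Z * H))" by simp
  have adjm: "adj (Y - Z) = adj Y - adj Z" by (rule eq_matI) (auto simp: D)
  have "0 \<le> Re (mtrace (adj (Y - Z) * X * (Y - Z) * H))"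
    by (rule mtrace_congr_nonneg[OF X H]) (simp_all add: D)
  also have "adj (Y - Z) * X * (Y - Z) * H
      = (adj Y * X * Y * H - adj Y * X * Z * H) - (adj Z * X * Y * H - adj Z * X * Z * H)"
    by (simp add: adjm minus_mult_dim mult_minus_dim D)
       (rule eq_matI, auto simp: D)
  also have "mtrace \<dots> = mtrace (adj Y * X * Y * H) - mtrace (adj Y * X * Z * H)
      - (mtrace (adj Z * X * Y * H) - mtrace (adj Z * X * Z * H))"
    by (simp add: mtrace_minus D)
  finally show ?thesis using sym by simp
qed

section \<open>Joint concavity and convexity through Kraus operators\<close>

lemma mpow_inv:
  assumes "pos_def n A"
  shows "mpow A p * mpow A (-p) = 1\<^sub>m n" "mpow A (-p) * mpow A p = 1\<^sub>m n"
  using assms by (simp_all add: mpow_mult mpow_0)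

lemma strictly_positiveD: "strictly_positive n l \<Phi> \<Longrightarrow> pos_def n A \<Longrightarrow> pos_def l (\<Phi> A)"
  by (simp add: strictly_positive_def)

text \<open>\<open>mpow A (-r) * K c * mpow (\<Phi> (mpow A (-r))) (-1) * W\<close> minimises
  \<open>\<Sum>c. tr (Y c)* (mpow A r) (Y c) H\<close> subject to \<open>\<Sum>c. (K c)* (Y c) = W\<close>, with minimal value
  \<open>tr W* (mpow (\<Phi> (mpow A (-r))) (-1)) W H\<close>; so the latter inherits joint concavity from Lieb's
  theorem.\<close>

lemma kraus_lieb_concavity:
  assumes kr: "kraus n l \<Phi> N K" and sp: "strictly_positive n l \<Phi>"
    and A1: "pos_def n A1" and A2: "pos_def n A2" and U1: "pos_def l U1" and U2: "pos_def l U2"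
    and W: "dim_row W = l" "dim_col W = l" and r: "0 \<le> r" "r < 1" and t: "0 \<le> t" "t \<le> 1"
  shows "t * Re (mtrace (adj W * mpow (\<Phi> (mpow A1 (-r))) (-1) * W * mpow U1 (1 - r)))
      + (1 - t) * Re (mtrace (adj W * mpow (\<Phi> (mpow A2 (-r))) (-1) * W * mpow U2 (1 - r)))
    \<le> Re (mtrace (adj W * mpow (\<Phi> (mpow (mix t A1 A2) (-r))) (-1) * W * mpow (mix t U1 U2) (1 - r)))"
proof -
  define P where "P A = \<Phi> (mpow A (-r))" for A
  define Q where "Q A = mpow (P A) (-1)" for A
  define Y where "Y A c = mpow A (-r) * K c * Q A * W" for A c
  have P: "pos_def l (P A)" if "pos_def n A" for A
    unfolding P_def by (rule strictly_positiveD[OF sp pos_def_mpow[OF that]])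
  have Q: "pos_def l (Q A)" if "pos_def n A" for A
    unfolding Q_def by (rule pos_def_mpow[OF P[OF that]])
  have PQ: "P A * Q A = 1\<^sub>m l" "Q A * P A = 1\<^sub>m l" if "pos_def n A" for A
    using mpow_inv[OF P[OF that], of 1] by (simp_all add: Q_def mpow_1[OF P[OF that]])
  have dK: "dim_row (K c) = n" "dim_col (K c) = l" if "c < N" for c
    using kr that by (auto simp: kraus_def)
  \<comment> \<open>The power of \<open>B\<close> cancels against the one inside
    \<open>Y B c\<close>, and the sum over \<open>c\<close> rebuilds \<open>P A\<close>, which
    \<open>Q A\<close> cancels. The value is therefore free of \<open>A\<close>: all families
    \<open>Y A\<close> satisfy the same linear constraint.\<close>
  have core: "(\<Sum>c<N. mtrace (adj (Y A c) * mpow B r * Y B c * H)) = mtrace (adj W * Q B * W * H)"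
    if A: "pos_def n A" and B: "pos_def n B" and H: "pos_def l H" for A B H
  proof -
    note D = pos_defD[OF P[OF A]] pos_defD[OF P[OF B]] pos_defD[OF Q[OF A]] pos_defD[OF Q[OF B]] mpow_dim[OF A] mpow_dim[OF B] pos_defD[OF H] W
    have "mtrace (adj (Y A c) * mpow B r * Y B c * H) = mtrace (adj (K c) * mpow A (-r) * K c * (Q B * W * H * adj W * Q A))"
      if c: "c < N" for c
    proof -
      note D' = D dK[OF c]
      have "adj (Y A c) * mpow B r * Y B c * H
          = (adj W * Q A) * (adj (K c) * mpow A (-r) * (mpow B r * (mpow B (-r) * (K c * (Q B * W * H)))))"
        by (simp add: Y_def adj_mult assoc_dim D')
      also have "mpow B r * (mpow B (-r) * (K c * (Q B * W * H))) = K c * (Q B * W * H)"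
        by (rule mult_cancel_dim[OF mpow_inv(1)[OF B]]) (simp_all add: D')
      also have "mtrace ((adj W * Q A) * (adj (K c) * mpow A (-r) * (K c * (Q B * W * H))))
          = mtrace ((adj (K c) * mpow A (-r) * (K c * (Q B * W * H))) * (adj W * Q A))"
        by (rule mtrace_mult_comm) (simp_all add: D')
      also have "(adj (K c) * mpow A (-r) * (K c * (Q B * W * H))) * (adj W * Q A)
          = adj (K c) * mpow A (-r) * K c * (Q B * W * H * adj W * Q A)"
        by (simp add: assoc_dim D')
      finally show ?thesis .
    qed
    hence "(\<Sum>c<N. mtrace (adj (Y A c) * mpow B r * Y B c * H))
        = (\<Sum>c<N. mtrace (adj (K c) * mpow A (-r) * K c * (Q B * W * H * adj W * Q A)))"
      by simp
    also have "\<dots> = mtrace (P A * (Q B * W * H * adj W * Q A))"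
    proof -
      have "mpow A (-r) \<in> carrier_mat n n" "Q B * W * H * adj W * Q A \<in> carrier_mat l l"
        by (auto intro!: carrier_matI simp: D)
      thus ?thesis using kr unfolding kraus_def P_def by simp
    qed
    also have "\<dots> = mtrace ((Q B * W * H * adj W * Q A) * P A)"
      by (rule mtrace_mult_comm) (simp_all add: D)
    also have "(Q B * W * H * adj W * Q A) * P A = (Q B * W * H) * adj W"
      by (simp add: assoc_dim D PQ[OF A] mult_one_dim)
    also have "mtrace \<dots> = mtrace (adj W * (Q B * W * H))"
      by (rule mtrace_mult_comm) (simp_all add: D)
    also have "adj W * (Q B * W * H) = adj W * Q B * W * H" by (simp add: assoc_dim D)
    finally show ?thesis .
  qed
  define A where "A = mix t A1 A2"
  define U where "U = mix t U1 U2"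
  have A: "pos_def n A" unfolding A_def by (rule pos_def_mix[OF A1 A2 t])
  have U: "pos_def l U" unfolding U_def by (rule pos_def_mix[OF U1 U2 t])
  have dY: "dim_row (Y B c) = n" "dim_col (Y B c) = l" if "pos_def n B" for B c
    by (simp_all add: Y_def mpow_dim[OF that] W)
  \<comment> \<open>Completing the square between the families of \<open>A\<close> and of
    \<open>B\<close>. By \<open>core\<close> the cross term and the value at the family of
    \<open>B\<close> are the same number.\<close>
  have lower: "Re (mtrace (adj W * Q B * W * H)) \<le> (\<Sum>c<N. Re (mtrace (adj (Y A c) * mpow B r * Y A c * H)))"
    if B: "pos_def n B" and H: "pos_def l H" for B H
  proof -
    have "2 * Re (mtrace (adj W * Q B * W * H)) = (\<Sum>c<N. 2 * Re (mtrace (adj (Y A c) * mpow B r * Y B c * H)))"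
      unfolding core[OF A B H, symmetric] by (simp add: sum_distrib_left)
    also have "\<dots> \<le> (\<Sum>c<N. Re (mtrace (adj (Y A c) * mpow B r * Y A c * H)) + Re (mtrace (adj (Y B c) * mpow B r * Y B c * H)))"
      by (intro sum_mono mtrace_square_expand[OF pos_def_mpow[OF B] H]) (simp_all add: dY A B)
    also have "\<dots> = (\<Sum>c<N. Re (mtrace (adj (Y A c) * mpow B r * Y A c * H))) + Re (mtrace (adj W * Q B * W * H))"
      unfolding core[OF B B H, symmetric] by (simp add: sum.distrib)
    finally show ?thesis by simp
  qed
  \<comment> \<open>The family of the mixture competes at both endpoints. With \<open>Y A c\<close>
    thus held fixed, Lieb's theorem applies to each summand.\<close>
  have "t * Re (mtrace (adj W * Q A1 * W * mpow U1 (1 - r))) + (1 - t) * Re (mtrace (adj W * Q A2 * W * mpow U2 (1 - r)))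
    \<le> t * (\<Sum>c<N. Re (mtrace (adj (Y A c) * mpow A1 r * Y A c * mpow U1 (1 - r))))
    + (1 - t) * (\<Sum>c<N. Re (mtrace (adj (Y A c) * mpow A2 r * Y A c * mpow U2 (1 - r))))"
    using t by (intro add_mono mult_left_mono lower A1 A2 pos_def_mpow U1 U2) auto
  also have "\<dots> = (\<Sum>c<N. t * Re (mtrace (adj (Y A c) * mpow A1 r * Y A c * mpow U1 (1 - r)))
    + (1 - t) * Re (mtrace (adj (Y A c) * mpow A2 r * Y A c * mpow U2 (1 - r))))"
    by (simp add: sum.distrib sum_distrib_left)
  also have "\<dots> \<le> (\<Sum>c<N. Re (mtrace (adj (Y A c) * mpow A r * Y A c * mpow U (1 - r))))"
    unfolding A_def U_def
    by (rule sum_mono, rule lieb_concavity[OF A1 A2 U1 U2 _ _ r t]) (simp_all add: dY A[unfolded A_def])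
  also have "\<dots> = Re (mtrace (adj W * Q A * W * mpow U (1 - r)))"
    unfolding core[OF A A pos_def_mpow[OF U], symmetric] by simp
  finally show ?thesis by (simp add: Q_def P_def A_def U_def)
qed

text \<open>For a single Kraus operator K the trace is the maximum over Y of 2 Re Tr (adj Y) B K -
  Tr (adj Y) Y Z, which is affine in (B, Z), and Y = B K Z^(-1) attains it. The maximiser of the
  mixture is tested at both endpoints.\<close>

lemma kraus_square_inverse_convex:
  assumes kr: "kraus m l \<Psi> N K"
    and B1: "pos_def m B1" and B2: "pos_def m B2" and Z1: "pos_def l Z1" and Z2: "pos_def l Z2"
    and t: "0 \<le> t" "t \<le> 1"
  shows "Re (mtrace (\<Psi> (mix t B1 B2 * mix t B1 B2) * mpow (mix t Z1 Z2) (-1)))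
    \<le> t * Re (mtrace (\<Psi> (B1 * B1) * mpow Z1 (-1))) + (1 - t) * Re (mtrace (\<Psi> (B2 * B2) * mpow Z2 (-1)))"
proof -
  define Y where "Y B Z c = B * K c * mpow Z (-1)" for B Z c
  have dK: "dim_row (K c) = m" "dim_col (K c) = l" if "c < N" for c
    using kr that by (auto simp: kraus_def)
  have one: "pos_def m (1\<^sub>m m)" using pos_def_mpow[OF B1, of 0] by (simp add: mpow_0[OF B1])
  have inv: "mpow Z (-1) * Z = 1\<^sub>m l" if "pos_def l Z" for Z
    using mpow_inv(2)[OF that, of 1] by (simp add: mpow_1[OF that])
  have YZ: "mtrace (adj (Y B Z c) * 1\<^sub>m m * Y B' Z' c * Z') = mtrace (adj (Y B Z c) * B' * K c)"
    if B: "pos_def m B" "pos_def m B'" and Z: "pos_def l Z" "pos_def l Z'" and c: "c < N" for B B' Z Z' c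
  proof -
    note D = pos_defD[OF B(1)] pos_defD[OF B(2)] pos_defD[OF Z(1)] pos_defD[OF Z(2)] mpow_dim[OF Z(1)] mpow_dim[OF Z(2)] dK[OF c]
    show ?thesis by (simp add: Y_def assoc_dim D mult_one_dim inv[OF Z(2)])
  qed
  have G: "mtrace (\<Psi> (B * B) * mpow Z (-1)) = (\<Sum>c<N. mtrace (adj (Y B Z c) * 1\<^sub>m m * Y B Z c * Z))"
    if B: "pos_def m B" and Z: "pos_def l Z" for B Z
  proof -
    note D = pos_defD[OF B] pos_defD[OF Z] mpow_dim[OF Z]
    have "B * B \<in> carrier_mat m m" "mpow Z (-1) \<in> carrier_mat l l" by (auto intro!: carrier_matI simp: D)
    hence "mtrace (\<Psi> (B * B) * mpow Z (-1)) = (\<Sum>c<N. mtrace (adj (K c) * (B * B) * K c * mpow Z (-1)))"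
      using kr by (simp add: kraus_def)
    also have "\<dots> = (\<Sum>c<N. mtrace (adj (Y B Z c) * 1\<^sub>m m * Y B Z c * Z))"
    proof (rule sum.cong[OF refl])
      fix c assume "c \<in> {..<N}"
      hence c: "c < N" by simp
      have "mtrace (adj (K c) * (B * B) * K c * mpow Z (-1)) = mtrace (mpow Z (-1) * (adj (K c) * (B * B) * K c))"
        by (rule mtrace_mult_comm) (simp_all add: D dK[OF c])
      also have "mpow Z (-1) * (adj (K c) * (B * B) * K c) = adj (Y B Z c) * B * K c"
        by (simp add: Y_def adj_mult assoc_dim D dK[OF c])
      finally show "mtrace (adj (K c) * (B * B) * K c * mpow Z (-1)) = mtrace (adj (Y B Z c) * 1\<^sub>m m * Y B Z c * Z)"
        using YZ[OF B B Z Z c] by simp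
    qed
    finally show ?thesis .
  qed
  define B where "B = mix t B1 B2"
  define Z where "Z = mix t Z1 Z2"
  have B: "pos_def m B" unfolding B_def by (rule pos_def_mix[OF B1 B2 t])
  have Z: "pos_def l Z" unfolding Z_def by (rule pos_def_mix[OF Z1 Z2 t])
  have main: "Re (mtrace (adj (Y B Z c) * 1\<^sub>m m * Y B Z c * Z)) \<le>
      t * Re (mtrace (adj (Y B1 Z1 c) * 1\<^sub>m m * Y B1 Z1 c * Z1)) + (1 - t) * Re (mtrace (adj (Y B2 Z2 c) * 1\<^sub>m m * Y B2 Z2 c * Z2))"
    if c: "c < N" for c
  proof -
    note D = pos_defD[OF B] pos_defD[OF B1] pos_defD[OF B2] pos_defD[OF Z] pos_defD[OF Z1] pos_defD[OF Z2]
      mpow_dim[OF Z] dK[OF c]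
    have dY: "dim_row (Y B' Z' c) = m" "dim_col (Y B' Z' c) = l" if "pos_def m B'" "pos_def l Z'" for B' Z'
      by (simp_all add: Y_def pos_defD[OF that(1)] mpow_dim[OF that(2)])
    have sq: "2 * Re (mtrace (adj (Y B Z c) * B' * K c)) \<le> Re (mtrace (adj (Y B Z c) * 1\<^sub>m m * Y B Z c * Z'))
       + Re (mtrace (adj (Y B' Z' c) * 1\<^sub>m m * Y B' Z' c * Z'))" if "pos_def m B'" "pos_def l Z'" for B' Z'
      unfolding YZ[OF B that(1) Z that(2) c, symmetric]
      by (rule mtrace_square_expand[OF one that(2)]) (simp_all add: dY B Z that)
    have 1: "Re (mtrace (adj (Y B Z c) * B * K c)) = t * Re (mtrace (adj (Y B Z c) * B1 * K c)) + (1 - t) * Re (mtrace (adj (Y B Z c) * B2 * K c))"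
      using mtrace_mix[of "adj (Y B Z c)" m B1 B2 m "K c" l t] by (simp add: D dY B Z B_def[symmetric])
    have 2: "Re (mtrace (adj (Y B Z c) * 1\<^sub>m m * Y B Z c * Z)) = t * Re (mtrace (adj (Y B Z c) * 1\<^sub>m m * Y B Z c * Z1))
        + (1 - t) * Re (mtrace (adj (Y B Z c) * 1\<^sub>m m * Y B Z c * Z2))"
      using mtrace_mix[of "adj (Y B Z c) * 1\<^sub>m m * Y B Z c" l Z1 Z2 l "1\<^sub>m l" l t]
      by (simp add: D dY B Z mult_one_dim Z_def[symmetric])
    have 3: "Re (mtrace (adj (Y B Z c) * 1\<^sub>m m * Y B Z c * Z)) = Re (mtrace (adj (Y B Z c) * B * K c))"
      using YZ[OF B B Z Z c] by simp
    have "t * (2 * Re (mtrace (adj (Y B Z c) * B1 * K c))) + (1 - t) * (2 * Re (mtrace (adj (Y B Z c) * B2 * K c)))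
      \<le> t * (Re (mtrace (adj (Y B Z c) * 1\<^sub>m m * Y B Z c * Z1)) + Re (mtrace (adj (Y B1 Z1 c) * 1\<^sub>m m * Y B1 Z1 c * Z1)))
      + (1 - t) * (Re (mtrace (adj (Y B Z c) * 1\<^sub>m m * Y B Z c * Z2)) + Re (mtrace (adj (Y B2 Z2 c) * 1\<^sub>m m * Y B2 Z2 c * Z2)))"
      using t sq[OF B1 Z1] sq[OF B2 Z2] by (intro add_mono mult_left_mono) auto
    thus ?thesis using 1 2 3 by (simp add: algebra_simps)
  qed
  have "Re (mtrace (\<Psi> (B * B) * mpow Z (-1))) = (\<Sum>c<N. Re (mtrace (adj (Y B Z c) * 1\<^sub>m m * Y B Z c * Z)))"
    unfolding G[OF B Z] by simp
  also have "\<dots> \<le> (\<Sum>c<N. t * Re (mtrace (adj (Y B1 Z1 c) * 1\<^sub>m m * Y B1 Z1 c * Z1)) + (1 - t) * Re (mtrace (adj (Y B2 Z2 c) * 1\<^sub>m m * Y B2 Z2 c * Z2)))"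
    by (rule sum_mono, rule main) simp
  also have "\<dots> = t * Re (mtrace (\<Psi> (B1 * B1) * mpow Z1 (-1))) + (1 - t) * Re (mtrace (\<Psi> (B2 * B2) * mpow Z2 (-1)))"
    unfolding G[OF B1 Z1] G[OF B2 Z2] by (simp add: sum.distrib sum_distrib_left)
  finally show ?thesis by (simp only: B_def Z_def)
qed

section \<open>Joint convexity\<close>

lemma pos_def_sandwich:
  assumes P: "pos_def l P" and Z: "pos_def l Z"
  shows "pos_def l (mpow P p * Z * mpow P p)"
  using pos_def_congruence[OF Z, of "mpow P p" l "mpow P (-p)"] mpow_inv(2)[OF P, of p]
  by (simp add: mpow_dim[OF P])

lemma sandwich_cancel:
  assumes P: "pos_def l P" and Z: "dim_row Z = l" "dim_col Z = l"
  shows "mpow P p * (mpow P (-p) * Z * mpow P (-p)) * mpow P p = Z"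
proof -
  note D = mpow_dim[OF P] Z
  have "mpow P p * (mpow P (-p) * Z * mpow P (-p)) * mpow P p = mpow P p * (mpow P (-p) * (Z * (mpow P (-p) * mpow P p)))"
    by (simp add: assoc_dim D)
  also have "\<dots> = Z * (mpow P (-p) * mpow P p)"
    by (rule mult_cancel_dim[OF mpow_inv(1)[OF P]]) (simp_all add: D)
  finally show ?thesis by (simp add: mpow_inv[OF P] mult_one_dim D)
qed

lemma mpow_inverse_unique:
  assumes Z: "pos_def l Z" and B: "dim_row B = l" "Z * B = 1\<^sub>m l"
  shows "mpow Z (-1) = B"
proof -
  note D = pos_defD[OF Z] mpow_dim[OF Z] B(1)
  have "mpow Z (-1) * (Z * B) = B"
    by (rule mult_cancel_dim) (use mpow_inv(2)[OF Z, of 1] in \<open>simp_all add: mpow_1[OF Z] D\<close>)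
  thus ?thesis by (simp add: B D mult_one_dim)
qed

text \<open>The inverse of the sandwich carries P^(-1/2) on both sides, and these cancel the outer
  factors around \<open>Q\<close> under the trace. This is what removes \<open>A\<close> from the
  first term of the variational formula.\<close>

lemma mtrace_sandwich_inverse:
  assumes P: "pos_def l P" and Z: "pos_def l Z" and Q: "dim_row Q = l" "dim_col Q = l"
  shows "mtrace (mpow P (1/2) * Q * mpow P (1/2) * mpow (mpow P (1/2) * Z * mpow P (1/2)) (-1)) = mtrace (Q * mpow Z (-1))"
proof -
  define R where "R = mpow P (1/2)"
  define S where "S = mpow P (-(1/2))"
  have RS: "R * S = 1\<^sub>m l" "S * R = 1\<^sub>m l" unfolding R_def S_def by (rule mpow_inv[OF P])+
  have dR: "dim_row R = l" "dim_col R = l" "dim_row S = l" "dim_col S = l" by (simp_all add: R_def S_def mpow_dim[OF P])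
  note D = dR pos_defD[OF Z] mpow_dim[OF Z] Q
  have ZZ: "Z * mpow Z (-1) = 1\<^sub>m l" using mpow_inv(1)[OF Z, of 1] by (simp add: mpow_1[OF Z])
  have T: "pos_def l (R * Z * R)" unfolding R_def by (rule pos_def_sandwich[OF P Z])
  have "mpow (R * Z * R) (-1) = S * mpow Z (-1) * S"
  proof (rule mpow_inverse_unique[OF T])
    have "R * Z * R * (S * mpow Z (-1) * S) = R * (Z * (R * (S * (mpow Z (-1) * S))))"
      by (simp add: assoc_dim D)
    also have "R * (S * (mpow Z (-1) * S)) = mpow Z (-1) * S"
      by (rule mult_cancel_dim[OF RS(1)]) (simp_all add: D)
    also have "Z * (mpow Z (-1) * S) = S"
      by (rule mult_cancel_dim[OF ZZ]) (simp_all add: D)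
    finally show "R * Z * R * (S * mpow Z (-1) * S) = 1\<^sub>m l" by (simp add: RS)
  qed (simp add: D)
  hence "mtrace (R * Q * R * mpow (R * Z * R) (-1)) = mtrace (R * (Q * (R * (S * (mpow Z (-1) * S)))))"
    by (simp add: assoc_dim D)
  also have "R * (S * (mpow Z (-1) * S)) = mpow Z (-1) * S"
    by (rule mult_cancel_dim[OF RS(1)]) (simp_all add: D)
  also have "mtrace (R * (Q * (mpow Z (-1) * S))) = mtrace ((Q * (mpow Z (-1) * S)) * R)"
    by (rule mtrace_mult_comm) (simp_all add: D)
  also have "(Q * (mpow Z (-1) * S)) * R = Q * mpow Z (-1)"
    by (simp add: assoc_dim D RS mult_one_dim)
  finally show ?thesis by (simp add: R_def)
qed

text \<open>Polar decomposition of \<open>mpow P (-1/2) * W\<close>: its unitary part rotates the sandwich.\<close>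

lemma rotated_sandwich:
  assumes P: "pos_def l P" and Z: "pos_def l Z" and W: "dim_row W = l" "dim_col W = l"
    and V: "dim_row W' = l" "dim_col W' = l" "W' * W = 1\<^sub>m l"
  obtains U where "pos_def l U" "mtrace (adj W * mpow P (-1) * W * U) = mtrace (adj W * Z * W)"
    "\<And>f. mtrace (mfun f U) = mtrace (mfun f (mpow P (1/2) * Z * mpow P (1/2)))"
proof -
  define R where "R = mpow P (1/2)"
  define S where "S = mpow P (-(1/2))"
  define T where "T = R * Z * R"
  have T: "pos_def l T" unfolding T_def R_def by (rule pos_def_sandwich[OF P Z])
  have RS: "R * S = 1\<^sub>m l" "S * R = 1\<^sub>m l" unfolding R_def S_def by (rule mpow_inv[OF P])+
  have SS: "S * S = mpow P (-1)" unfolding S_def by (simp add: mpow_mult[OF P])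
  have dR: "dim_row R = l" "dim_col R = l" "dim_row S = l" "dim_col S = l" "adj R = R" "adj S = S"
    by (simp_all add: R_def S_def mpow_dim[OF P])
  note D = dR pos_defD[OF Z] pos_defD[OF T] mpow_dim[OF P] W V(1,2)
  define N where "N = S * W"
  have dN: "dim_row N = l" "dim_col N = l" by (simp_all add: N_def D)
  define H where "H = adj N * N"
  have HW: "H = adj W * mpow P (-1) * W"
    by (simp add: H_def N_def adj_mult assoc_dim D flip: SS)
  \<comment> \<open>\<open>W' * R\<close> is a left inverse of \<open>N\<close>, so \<open>H\<close>
    is positive definite and has an inverse square root.\<close>
  have "R * (S * W) = W" by (rule mult_cancel_dim[OF RS(1)]) (simp_all add: D)
  hence "W' * R * N = 1\<^sub>m l" using V(3) by (simp add: N_def assoc_dim D)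
  moreover have one: "pos_def l (1\<^sub>m l)" using pos_def_mpow[OF P, of 0] by (simp add: mpow_0[OF P])
  ultimately have "pos_def l (adj N * 1\<^sub>m l * adj (adj N))"
    by (intro pos_def_congruence[OF one, of _ _ "W' * R"]) (simp_all add: D dN)
  hence H: "pos_def l H" by (simp add: H_def mult_one_dim dN)
  define G where "G = mpow H (-(1/2))"
  have dG: "dim_row G = l" "dim_col G = l" "adj G = G" by (simp_all add: G_def mpow_dim[OF H])
  have HG: "H * G = mpow H (1/2)" unfolding G_def
    using mpow_mult[OF H, of 1 "-(1/2)"] by (simp add: mpow_1[OF H])
  have GHG: "G * (H * G) = 1\<^sub>m l" "H * G * G = 1\<^sub>m l"
    unfolding HG unfolding G_def using mpow_inv[OF H, of "1/2"] by simp_all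
  \<comment> \<open>Here N = X H^(1/2). In the trace of H times \<open>adj X * T * X\<close> the
    outer powers of \<open>H\<close> cancel, leaving \<open>adj N * T * N\<close>, and S T S = Z
    removes the sandwich.\<close>
  define X where "X = N * G"
  have dX: "dim_row X = l" "dim_col X = l" by (simp_all add: X_def dN dG)
  have "adj X * X = G * (H * G)" by (simp add: X_def H_def adj_mult assoc_dim dN dG)
  hence X: "unitary l X" using GHG carrier_matI[OF dX] by (simp add: unitary_def)
  define U where "U = adj X * T * X"
  have U': "U = adj X * T * adj (adj X)" by (simp add: U_def)
  have U: "pos_def l U"
    unfolding U' by (rule pos_def_congruence[OF T, of _ _ "adj X"])
      (simp_all add: dX unitary_left[OF X])
  have "mtrace (mfun f U) = mtrace (mfun f T)" for f
  proof -
    have "mfun f U = adj X * mfun f T * X"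
      using mfun_conj[OF T unitary_adj[OF X], of f] by (simp add: U_def)
    also have "mtrace \<dots> = mtrace (X * (adj X * mfun f T))"
      by (rule mtrace_mult_comm) (simp_all add: dX mfun_dim[OF T])
    also have "X * (adj X * mfun f T) = mfun f T"
      by (rule mult_cancel_dim[OF unitary_right[OF X]]) (simp_all add: dX mfun_dim[OF T])
    finally show ?thesis .
  qed
  moreover have "mtrace (adj W * mpow P (-1) * W * U) = mtrace (adj W * Z * W)"
  proof -
    have dH: "dim_row H = l" "dim_col H = l" using pos_defD[OF H] by auto
    have "mtrace (H * U) = mtrace ((H * G * adj N * T * N) * G)"
      by (simp add: U_def X_def adj_mult assoc_dim D dN dG dH)
    also have "\<dots> = mtrace (G * (H * G * adj N * T * N))"
      by (rule mtrace_mult_comm) (simp_all add: D dN dG dH)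
    also have "G * (H * G * adj N * T * N) = (G * (H * G)) * (adj N * T * N)"
      by (simp add: assoc_dim D dN dG dH)
    also have "\<dots> = adj N * T * N" by (simp add: GHG mult_one_dim dN)
    also have "\<dots> = adj W * (S * T * S) * W"
      by (simp add: N_def adj_mult assoc_dim D)
    also have "S * T * S = Z"
      using sandwich_cancel[OF P, of Z "-(1/2)"] by (simp add: T_def S_def R_def pos_defD[OF Z])
    finally show ?thesis by (simp add: HW)
  qed
  ultimately show ?thesis using that[OF U] by (simp add: T_def R_def)
qed

text \<open>\<open>W\<close> is fixed from the mixture. At each endpoint some U makes the two terms
  with \<open>W\<close> cancel while Tr kk(U) equals Tr h(T); at the mixture no U brings the
  expression below Tr h(T0). For fixed \<open>W\<close> the expression is jointly convex in (A, Z,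
  U), so mixing the endpoint choices of U gives the inequality.\<close>

lemma sandwich_convex_strict:
  assumes kr: "kraus n l \<Phi> N K" and sp: "strictly_positive n l \<Phi>"
    and k: "convex_on {0<..} k" "mono_on {0<..} k" and \<delta>: "0 < \<delta>"
    and A1: "pos_def n A1" and A2: "pos_def n A2" and Z1: "pos_def l Z1" and Z2: "pos_def l Z2"
    and r: "0 \<le> r" "r < 1" and t: "0 \<le> t" "t \<le> 1"
  defines "T \<equiv> \<lambda>A Z. mpow (\<Phi> (mpow A (-r))) (1/2) * Z * mpow (\<Phi> (mpow A (-r))) (1/2)"
    and "h \<equiv> \<lambda>\<tau>. k (\<tau> powr (1 / (1 - r))) + \<delta> * \<tau> powr (1 / (1 - r))"
  shows "Re (mtrace (mfun h (T (mix t A1 A2) (mix t Z1 Z2))))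
    \<le> t * Re (mtrace (mfun h (T A1 Z1))) + (1 - t) * Re (mtrace (mfun h (T A2 Z2)))"
proof -
  define s where "s = 1 / (1 - r)"
  have sr: "s * (1 - r) = 1" using r by (simp add: s_def)
  define kk where "kk u = k u + \<delta> * u" for u
  have h: "h = (\<lambda>\<tau>. kk (\<tau> powr s))" by (simp add: h_def kk_def s_def)
  have kkc: "convex_on {0<..} kk"
    unfolding kk_def using \<delta> by (intro convex_on_add k convex_on_cmul) (auto simp: convex_on_ident)
  have "\<exists>y>0. \<forall>u>0. h \<tau> + y * (u powr (1 - r) - \<tau>) \<le> kk u" if "0 < \<tau>" for \<tau>
    using powr_subgradient[OF k \<delta> r that] by (simp add: h_def kk_def)
  then obtain y where y: "\<And>\<tau>. 0 < \<tau> \<Longrightarrow> 0 < y \<tau>"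
    "\<And>\<tau> u. 0 < \<tau> \<Longrightarrow> 0 < u \<Longrightarrow> h \<tau> + y \<tau> * (u powr (1 - r) - \<tau>) \<le> kk u" by metis
  define P where "P A = \<Phi> (mpow A (-r))" for A
  have P: "pos_def l (P A)" if "pos_def n A" for A
    unfolding P_def by (rule strictly_positiveD[OF sp pos_def_mpow[OF that]])
  define A where "A = mix t A1 A2"
  define Z where "Z = mix t Z1 Z2"
  have A: "pos_def n A" unfolding A_def by (rule pos_def_mix[OF A1 A2 t])
  have Z: "pos_def l Z" unfolding Z_def by (rule pos_def_mix[OF Z1 Z2 t])
  define T0 where "T0 = T A Z"
  define R where "R = mpow (P A) (1/2)"
  define S where "S = mpow (P A) (-(1/2))"
  have T0R: "T0 = R * Z * R" by (simp add: T0_def T_def R_def P_def)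
  have T0: "pos_def l T0" unfolding T0R R_def by (rule pos_def_sandwich[OF P[OF A] Z])
  have RS: "R * S = 1\<^sub>m l" "S * R = 1\<^sub>m l" unfolding R_def S_def by (rule mpow_inv[OF P[OF A]])+
  have SS: "mpow (P A) (-1) = S * S" unfolding S_def by (simp add: mpow_mult[OF P[OF A]])
  have dR: "dim_row R = l" "dim_col R = l" "dim_row S = l" "dim_col S = l" "adj R = R" "adj S = S"
    by (simp_all add: R_def S_def mpow_dim[OF P[OF A]])
  \<comment> \<open>With W = R Y, the product \<open>adj W * mpow (P A) (-1) * W\<close> collapses
    to y(T0), a function of \<open>T0\<close>.\<close>
  define Y where "Y = mfun (\<lambda>\<tau>. sqrt (y \<tau>)) T0"
  \<comment> \<open>The inverse of \<open>Y\<close>: \<delta> guarantees that \<open>y\<close> is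
    strictly positive, and \<open>rotated_sandwich\<close> asks for a left inverse of
    \<open>W\<close>.\<close>
  define Y' where "Y' = mfun (\<lambda>\<tau>. 1 / sqrt (y \<tau>)) T0"
  have YY': "Y' * Y = 1\<^sub>m l"
  proof -
    have "Y' * Y = mfun (\<lambda>\<tau>. 1 / sqrt (y \<tau>) * sqrt (y \<tau>)) T0" unfolding Y_def Y'_def by (rule mfun_mult[OF T0])
    also have "\<dots> = mfun (\<lambda>_. 1) T0"
    proof (rule mfun_cong[OF T0])
      fix x :: real assume "0 < x"
      thus "1 / sqrt (y x) * sqrt (y x) = 1" using y(1)[of x] by simp
    qed
    finally show ?thesis by (simp add: mfun_const[OF T0])
  qed
  have YY: "Y * Y = mfun y T0"
  proof -
    have "Y * Y = mfun (\<lambda>\<tau>. sqrt (y \<tau>) * sqrt (y \<tau>)) T0" unfolding Y_def by (rule mfun_mult[OF T0])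
    also have "\<dots> = mfun y T0" by (rule mfun_cong[OF T0]) (simp add: y(1) less_imp_le)
    finally show ?thesis .
  qed
  have dY: "dim_row Y = l" "dim_col Y = l" "adj Y = Y" "dim_row Y' = l" "dim_col Y' = l"
    by (simp_all add: Y_def Y'_def mfun_dim[OF T0])
  note D = dR dY pos_defD[OF Z] pos_defD[OF Z1] pos_defD[OF Z2] pos_defD[OF T0] mfun_dim[OF T0]
  define W where "W = R * Y"
  have dW: "dim_row W = l" "dim_col W = l" by (simp_all add: W_def D)
  have "S * (R * Y) = Y" by (rule mult_cancel_dim[OF RS(2)]) (simp_all add: D)
  hence W': "Y' * S * W = 1\<^sub>m l" "dim_row (Y' * S) = l" "dim_col (Y' * S) = l"
    by (simp_all add: W_def assoc_dim D YY')
  \<comment> \<open>The power \<open>s\<close> of the rotated sandwich is taken, so that U^(1-r) is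
    the rotated sandwich itself and kk(U) has the trace of h at the sandwich.\<close>
  have ex: "\<exists>U. pos_def l U \<and> mtrace (adj W * mpow (P B) (-1) * W * mpow U (1 - r)) = mtrace (adj W * X * W)
      \<and> mtrace (mfun kk U) = mtrace (mfun h (T B X))" if B: "pos_def n B" and X: "pos_def l X" for B X
  proof -
    obtain U where U: "pos_def l U" "mtrace (adj W * mpow (P B) (-1) * W * U) = mtrace (adj W * X * W)"
      "\<And>f. mtrace (mfun f U) = mtrace (mfun f (mpow (P B) (1/2) * X * mpow (P B) (1/2)))"
      by (rule rotated_sandwich[OF P[OF B] X dW W'(2,3,1)]) blast
    have "mpow (mpow U s) (1 - r) = U" using mpow_mpow[OF U(1), of s "1 - r"] by (simp add: sr mpow_1[OF U(1)])
    moreover have "mfun kk (mpow U s) = mfun h U" unfolding mpow_def h by (rule mfun_mfun[OF U(1)])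
    ultimately show ?thesis
      using U pos_def_mpow[OF U(1), of s] by (intro exI[of _ "mpow U s"]) (simp add: T_def P_def)
  qed
  obtain U1 where U1: "pos_def l U1" "mtrace (adj W * mpow (P A1) (-1) * W * mpow U1 (1 - r)) = mtrace (adj W * Z1 * W)"
     "mtrace (mfun kk U1) = mtrace (mfun h (T A1 Z1))" using ex[OF A1 Z1] by blast
  obtain U2 where U2: "pos_def l U2" "mtrace (adj W * mpow (P A2) (-1) * W * mpow U2 (1 - r)) = mtrace (adj W * Z2 * W)"
     "mtrace (mfun kk U2) = mtrace (mfun h (T A2 Z2))" using ex[OF A2 Z2] by blast
  define U where "U = mix t U1 U2"
  have U: "pos_def l U" unfolding U_def by (rule pos_def_mix[OF U1(1) U2(1) t])
  have WPW: "adj W * mpow (P A) (-1) * W = mfun y T0"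
  proof -
    have "adj W * mpow (P A) (-1) * W = Y * (R * (S * (S * (R * Y))))"
      by (simp add: W_def SS adj_mult assoc_dim D)
    also have "S * (R * Y) = Y" by (rule mult_cancel_dim[OF RS(2)]) (simp_all add: D)
    also have "R * (S * Y) = Y" by (rule mult_cancel_dim[OF RS(1)]) (simp_all add: D)
    finally show ?thesis by (simp add: YY)
  qed
  have WZW: "mtrace (adj W * Z * W) = mtrace (mfun (\<lambda>\<tau>. y \<tau> * \<tau>) T0)"
  proof -
    have "adj W * Z * W = Y * (T0 * Y)" by (simp add: W_def T0R adj_mult assoc_dim D)
    also have "mtrace \<dots> = mtrace ((T0 * Y) * Y)" by (rule mtrace_mult_comm) (simp_all add: D)
    also have "\<dots> = mtrace (T0 * (Y * Y))" by (simp add: assoc_dim D)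
    also have "\<dots> = mtrace ((Y * Y) * T0)" by (rule mtrace_mult_comm) (simp_all add: D)
    also have "(Y * Y) * T0 = mfun (\<lambda>\<tau>. y \<tau> * \<tau>) T0"
      using mfun_mult[OF T0, of y "\<lambda>x. x"] by (simp add: YY mfun_ident[OF T0])
    finally show ?thesis .
  qed
  have "Re (mtrace (adj W * Z * W)) = t * Re (mtrace (adj W * Z1 * W)) + (1 - t) * Re (mtrace (adj W * Z2 * W))"
    unfolding Z_def by (rule mtrace_mix) (simp_all add: D dW)
  also have "\<dots> \<le> Re (mtrace (adj W * mpow (P A) (-1) * W * mpow U (1 - r)))"
    using kraus_lieb_concavity[OF kr sp A1 A2 U1(1) U2(1) dW r t]
    by (simp add: P_def[symmetric] A_def[symmetric] U_def[symmetric] U1(2) U2(2))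
  finally have 1: "Re (mtrace (mfun (\<lambda>\<tau>. y \<tau> * \<tau>) T0)) \<le> Re (mtrace (mfun y T0 * mpow U (1 - r)))"
    by (simp add: WPW WZW)
  have 2: "Re (mtrace (mfun kk U)) \<le> t * Re (mtrace (mfun h (T A1 Z1))) + (1 - t) * Re (mtrace (mfun h (T A2 Z2)))"
    using mtrace_mfun_convex[OF kkc U1(1) U2(1) t] by (simp add: U_def U1(3) U2(3))
  \<comment> \<open>The lower bound at the mixture: the subgradient inequality for \<open>h\<close>,
    traced by Klein's inequality for the noncommuting pair \<open>T0\<close> and
    \<open>U\<close>.\<close>
  have "0 \<le> Re (mtrace (mfun (\<lambda>\<tau>. y \<tau> * \<tau> + (-1) * h \<tau>) T0)) + Re (mtrace (mfun (\<lambda>\<tau>. - y \<tau>) T0 * mfun (\<lambda>u. u powr (1 - r)) U))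
     + Re (mtrace (mfun kk U))"
  proof (rule klein_inequality[OF T0 U])
    fix \<tau> u :: real assume "0 < \<tau>" "0 < u"
    from y(2)[OF this] show "0 \<le> y \<tau> * \<tau> + (-1) * h \<tau> + - y \<tau> * u powr (1 - r) + kk u" by (simp add: algebra_simps)
  qed
  moreover have "Re (mtrace (mfun (\<lambda>\<tau>. - y \<tau>) T0 * mfun (\<lambda>u. u powr (1 - r)) U)) = - Re (mtrace (mfun y T0 * mpow U (1 - r)))"
  proof -
    have "mfun (\<lambda>\<tau>. - y \<tau>) T0 = (-1) \<cdot>\<^sub>m mfun y T0"
    proof -
      obtain V d where e: "eig l T0 V d" using pos_def_eig[OF T0] by blast
      note E = eig_dim[OF e]
      have "dg l (\<lambda>i. - y (d i)) = (-1) \<cdot>\<^sub>m dg l (\<lambda>i. y (d i))" by (rule eq_matI) (auto simp: dg_def)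
      thus ?thesis by (simp add: eig_mfun[OF e] smult_mult_dim E)
    qed
    thus ?thesis
      by (simp add: smult_mult_dim mtrace_smult D mfun_dim[OF U] mpow_def)
  qed
  ultimately have "Re (mtrace (mfun h T0)) \<le> Re (mtrace (mfun kk U))"
    using 1 unfolding mtrace_mfun_add[OF T0] by simp
  with 2 show ?thesis by (simp add: T0_def A_def Z_def)
qed

text \<open>Both sides of the perturbed inequality are affine in \<delta>, because the trace is
  additive in the function applied; letting \<delta> tend to 0 from the right removes the
  perturbation.\<close>

lemma sandwich_convex:
  assumes kr: "kraus n l \<Phi> N K" and sp: "strictly_positive n l \<Phi>"
    and k: "convex_on {0<..} k" "mono_on {0<..} k"
    and A1: "pos_def n A1" and A2: "pos_def n A2" and Z1: "pos_def l Z1" and Z2: "pos_def l Z2"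
    and r: "0 \<le> r" "r < 1" and t: "0 \<le> t" "t \<le> 1"
  defines "T \<equiv> \<lambda>A Z. mpow (\<Phi> (mpow A (-r))) (1/2) * Z * mpow (\<Phi> (mpow A (-r))) (1/2)"
    and "h \<equiv> \<lambda>\<tau>. k (\<tau> powr (1 / (1 - r)))"
  shows "Re (mtrace (mfun h (T (mix t A1 A2) (mix t Z1 Z2))))
    \<le> t * Re (mtrace (mfun h (T A1 Z1))) + (1 - t) * Re (mtrace (mfun h (T A2 Z2)))"
proof -
  let ?g = "\<lambda>\<tau>. \<tau> powr (1 / (1 - r))"
  have T: "pos_def l (T A Z)" if "pos_def n A" "pos_def l Z" for A Z
    unfolding T_def by (intro pos_def_sandwich strictly_positiveD[OF sp] pos_def_mpow that)
  have TM: "pos_def l (T (mix t A1 A2) (mix t Z1 Z2))"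
    by (intro T pos_def_mix A1 A2 Z1 Z2 t)
  define x where "x = Re (mtrace (mfun h (T (mix t A1 A2) (mix t Z1 Z2))))"
  define x' where "x' = Re (mtrace (mfun ?g (T (mix t A1 A2) (mix t Z1 Z2))))"
  define z where "z = t * Re (mtrace (mfun h (T A1 Z1))) + (1 - t) * Re (mtrace (mfun h (T A2 Z2)))"
  define z' where "z' = t * Re (mtrace (mfun ?g (T A1 Z1))) + (1 - t) * Re (mtrace (mfun ?g (T A2 Z2)))"
  have le: "x + \<delta> * x' \<le> z + \<delta> * z'" if "0 < \<delta>" for \<delta>
  proof -
    have "Re (mtrace (mfun (\<lambda>\<tau>. h \<tau> + \<delta> * ?g \<tau>) (T (mix t A1 A2) (mix t Z1 Z2))))
      \<le> t * Re (mtrace (mfun (\<lambda>\<tau>. h \<tau> + \<delta> * ?g \<tau>) (T A1 Z1))) + (1 - t) * Re (mtrace (mfun (\<lambda>\<tau>. h \<tau> + \<delta> * ?g \<tau>) (T A2 Z2)))"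
      unfolding T_def h_def by (rule sandwich_convex_strict[OF kr sp k that A1 A2 Z1 Z2 r t])
    thus ?thesis
      unfolding mtrace_mfun_add[OF TM] mtrace_mfun_add[OF T[OF A1 Z1]] mtrace_mfun_add[OF T[OF A2 Z2]]
      by (simp add: x_def x'_def z_def z'_def algebra_simps)
  qed
  have "x \<le> z"
  proof (rule tendsto_le[of "at_right 0" "\<lambda>\<delta>. z + \<delta> * z'" z "\<lambda>\<delta>. x + \<delta> * x'" x])
    show "((\<lambda>\<delta>. z + \<delta> * z') \<longlongrightarrow> z) (at_right 0)" "((\<lambda>\<delta>. x + \<delta> * x') \<longlongrightarrow> x) (at_right 0)"
      by (auto intro!: tendsto_eq_intros)
    show "\<forall>\<^sub>F \<delta> in at_right 0. x + \<delta> * x' \<le> z + \<delta> * z'"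
      unfolding eventually_at_right_field using le by (intro exI[of _ 1]) auto
  qed simp
  thus ?thesis by (simp add: x_def z_def)
qed

theorem theorem5p6:
  fixes n m l :: nat
    and \<Phi> \<Psi> :: "complex mat \<Rightarrow> complex mat"
    and p :: real
    and f :: "real \<Rightarrow> real"
  assumes lin\<Phi>: "lin_map n l \<Phi>" and sp\<Phi>: "strictly_positive n l \<Phi>"
    and cp\<Phi>: "completely_positive n l \<Phi>"
    and lin\<Psi>: "lin_map m l \<Psi>" and sp\<Psi>: "strictly_positive m l \<Psi>"
    and cp\<Psi>: "completely_positive m l \<Psi>"
    and p: "-1 \<le> p" "p \<le> 0"
    and f_mono: "mono_on {0<..} f"
    and f_concave: "concave_on {0<..} f"
    and f_lim: "((\<lambda>x. f x / x) \<longlongrightarrow> 0) at_top"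
    and f_conv: "convex_on {0<..} (\<lambda>x. f (x powr (2 + p)))"
  defines "F \<equiv> \<lambda>A B. Re (mtrace (mfun f
              (mpow (\<Phi> (mpow A p)) (1/2) * \<Psi> (B * B) * mpow (\<Phi> (mpow A p)) (1/2))))"
  assumes A1: "pos_def n A1" and A2: "pos_def n A2"
    and B1: "pos_def m B1" and B2: "pos_def m B2"
    and t: "0 \<le> t" "t \<le> (1::real)"
  shows "F (of_real t \<cdot>\<^sub>m A1 + of_real (1 - t) \<cdot>\<^sub>m A2) (of_real t \<cdot>\<^sub>m B1 + of_real (1 - t) \<cdot>\<^sub>m B2)
         \<le> t * F A1 B1 + (1 - t) * F A2 B2"
proof -
  define P where "P A = \<Phi> (mpow A p)" for A
  define Q where "Q B = \<Psi> (B * B)" for B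
  define X where "X A B = mpow (P A) (1/2) * Q B * mpow (P A) (1/2)" for A B
  have P: "pos_def l (P A)" if "pos_def n A" for A
    unfolding P_def by (rule strictly_positiveD[OF sp\<Phi> pos_def_mpow[OF that]])
  have Q: "pos_def l (Q B)" if B: "pos_def m B" for B
  proof -
    have "B * B = mpow B 2" using mpow_mult[OF B, of 1 1] by (simp add: mpow_1[OF B])
    thus ?thesis unfolding Q_def using strictly_positiveD[OF sp\<Psi> pos_def_mpow[OF B, of 2]] by simp
  qed
  have X: "pos_def l (X A B)" if "pos_def n A" "pos_def m B" for A B
    unfolding X_def by (intro pos_def_sandwich P Q that)
  have F: "F A B = Re (mtrace (mfun f (X A B)))" for A B by (simp add: F_def X_def P_def Q_def)
  define A where "A = mix t A1 A2"
  define B where "B = mix t B1 B2"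
  have A: "pos_def n A" unfolding A_def by (rule pos_def_mix[OF A1 A2 t])
  have B: "pos_def m B" unfolding B_def by (rule pos_def_mix[OF B1 B2 t])
  have tr1: "Re (mtrace (mfun (\<lambda>_. 1) (X A B))) = real l" if "pos_def n A" "pos_def m B" for A B
    by (simp add: mfun_const[OF X[OF that]] mtrace_def)
  have "F A B \<le> t * F A1 B1 + (1 - t) * F A2 B2"
  proof (cases "p = -1")
    \<comment> \<open>Here 2 + p = 1, so the convexity hypothesis speaks of \<open>f\<close> itself
      and the trace is the constant l f(1).\<close>
    case True
    have "convex_on {0<..} f"
    proof (rule convex_onI)
      fix s x y :: real assume s: "0 < s" "s < 1" "x \<in> {0<..}" "y \<in> {0<..}"
      hence "0 < (1 - s) * x + s * y" by (simp add: add_pos_pos)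
      thus "f ((1 - s) *\<^sub>R x + s *\<^sub>R y) \<le> (1 - s) * f x + s * f y"
        using convex_onD[OF f_conv, of s x y] s by (simp add: True)
    qed simp
    hence f: "f x = 0 + f 1 * 1" if "0 < x" for x
      using convex_sublinear_mono_const[OF f_mono _ f_lim that] by simp
    have "F A B = f 1 * l" if "pos_def n A" "pos_def m B" for A B
    proof -
      have "mfun f (X A B) = mfun (\<lambda>x. 0 + f 1 * 1) (X A B)"
        by (rule mfun_cong[OF X[OF that]]) (rule f)
      thus ?thesis
        using mtrace_mfun_add[OF X[OF that], of "\<lambda>_. 0" "f 1" "\<lambda>_. 1"]
          mtrace_mfun_add[OF X[OF that], of "\<lambda>_. 0" "1" "\<lambda>_. 0"] tr1[OF that] by (simp add: F)
    qed
    thus ?thesis by (simp add: A B A1 A2 B1 B2 algebra_simps)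
  next
    case False
    define r where "r = - p"
    have r: "0 \<le> r" "r < 1" and pr: "p = - r" using p False by (auto simp: r_def)
    obtain N K where kr\<Phi>: "kraus n l \<Phi> N K" by (rule kraus_exists[OF lin\<Phi> cp\<Phi>])
    obtain N' K' where kr\<Psi>: "kraus m l \<Psi> N' K'" by (rule kraus_exists[OF lin\<Psi> cp\<Psi>])
    define h where "h = legendre f"
    \<comment> \<open>Chosen so that \<open>h\<close> is \<open>k\<close> after the power 1/(1-r),
      the form in which \<open>sandwich_convex\<close> takes its function.\<close>
    define k where "k x = h (x powr (1 - r))" for x
    have hk: "k (\<tau> powr (1 / (1 - r))) = h \<tau>" if "0 < \<tau>" for \<tau>
      using that r by (simp add: k_def powr_powr)
    have k_conv: "convex_on {0<..} k"
      unfolding k_def h_def by (rule legendre_powr_convex[OF f_mono f_lim]) (use f_conv r in \<open>simp_all add: pr\<close>)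
    have k_mono: "mono_on {0<..} k"
    proof (rule mono_onI)
      fix x y :: real assume "x \<in> {0<..}" "y \<in> {0<..}" "x \<le> y"
      thus "k x \<le> k y" unfolding k_def h_def
        by (intro mono_onD[OF legendre_mono[OF f_mono f_lim]] powr_mono2) (use r in auto)
    qed
    define T where "T A Z = mpow (P A) (1/2) * Z * mpow (P A) (1/2)" for A Z
    have T: "pos_def l (T A Z)" if "pos_def n A" "pos_def l Z" for A Z
      unfolding T_def by (intro pos_def_sandwich P that)
    have tri: "Re (mtrace (X A B * mpow (T A Z) (-1))) = Re (mtrace (Q B * mpow Z (-1)))"
      if "pos_def n A" "pos_def m B" "pos_def l Z" for A B Z
      unfolding X_def T_def
      by (simp add: mtrace_sandwich_inverse[OF P[OF that(1)] that(3)] pos_defD[OF Q[OF that(2)]])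
    \<comment> \<open>Every \<open>Z\<close> is a competitor: the scalar bound f x \<le> x/\<tau> +
      h \<tau> is separately affine in functions of \<open>x\<close> and \<tau>, so Klein's
      inequality applies to \<open>X A B\<close> and \<open>T A Z\<close>.\<close>
    have upper: "F A B \<le> Re (mtrace (Q B * mpow Z (-1))) + Re (mtrace (mfun h (T A Z)))"
      if AB: "pos_def n A" "pos_def m B" "pos_def l Z" for A B Z
    proof -
      have "0 \<le> Re (mtrace (mfun (\<lambda>x. 0 + (-1) * f x) (X A B)))
          + Re (mtrace (mfun (\<lambda>x. x) (X A B) * mfun (\<lambda>x. x powr (-1)) (T A Z))) + Re (mtrace (mfun h (T A Z)))"
      proof (rule klein_inequality[OF X[OF AB(1,2)] T[OF AB(1,3)]])
        fix x \<tau> :: real assume "0 < x" "0 < \<tau>"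
        thus "0 \<le> 0 + (-1) * f x + x * \<tau> powr (-1) + h \<tau>"
          using legendre_upper[OF f_mono f_lim, of x \<tau>] by (simp add: h_def powr_minus_divide)
      qed
      thus ?thesis
        using mtrace_mfun_add[OF X[OF AB(1,2)], of "\<lambda>_. 0" "-1" f] mtrace_mfun_add[OF X[OF AB(1,2)], of "\<lambda>_. 0" 1 "\<lambda>_. 0"]
          tri[OF AB] by (simp add: F mfun_ident[OF X[OF AB(1,2)]] mpow_def)
    qed
    have lower: "\<exists>Z. pos_def l Z \<and> Re (mtrace (Q B * mpow Z (-1))) + Re (mtrace (mfun h (T A Z))) \<le> F A B + \<epsilon> * real l"
      if AB: "pos_def n A" "pos_def m B" and \<epsilon>: "0 < \<epsilon>" for A B and \<epsilon> :: real
    proof -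
      have "\<exists>\<tau>>0. x / \<tau> + h \<tau> \<le> f x + \<epsilon>" if "0 < x" for x
        unfolding h_def by (rule legendre_attained[OF f_mono f_lim f_concave that \<epsilon>])
      then obtain \<tau> where \<tau>: "\<And>x. 0 < x \<Longrightarrow> 0 < \<tau> x" "\<And>x. 0 < x \<Longrightarrow> x / \<tau> x + h (\<tau> x) \<le> f x + \<epsilon>" by metis
      \<comment> \<open>Choosing \<tau> eigenvalue by eigenvalue makes \<open>T0\<close> a function
        of \<open>X A B\<close>, so the trace estimate is a scalar one. \<open>Z\<close> is then
        solved from T A Z = T0.\<close>
      define T0 where "T0 = mfun \<tau> (X A B)"
      have T0: "pos_def l T0" unfolding T0_def by (rule pos_def_mfun[OF X[OF AB] \<tau>(1)])
      define Z where "Z = mpow (P A) (-(1/2)) * T0 * mpow (P A) (-(1/2))"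
      have Z: "pos_def l Z" unfolding Z_def by (rule pos_def_sandwich[OF P[OF AB(1)] T0])
      have TZ: "T A Z = T0" unfolding T_def Z_def
        by (rule sandwich_cancel[OF P[OF AB(1)]]) (simp_all add: pos_defD[OF T0])
      have "X A B * mpow T0 (-1) = mfun (\<lambda>x. x * (\<tau> x) powr (-1)) (X A B)"
        unfolding T0_def mpow_def mfun_mfun[OF X[OF AB]]
        using mfun_mult[OF X[OF AB], of "\<lambda>x. x"] by (simp add: mfun_ident[OF X[OF AB]])
      hence "Re (mtrace (Q B * mpow Z (-1))) + Re (mtrace (mfun h (T A Z)))
        = Re (mtrace (mfun (\<lambda>x. x * (\<tau> x) powr (-1) + 1 * h (\<tau> x)) (X A B)))"
        unfolding mtrace_mfun_add[OF X[OF AB]]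
        using tri[OF AB Z] by (simp add: TZ) (simp add: T0_def mfun_mfun[OF X[OF AB]])
      also have "\<dots> \<le> Re (mtrace (mfun (\<lambda>x. f x + \<epsilon> * 1) (X A B)))"
      proof (rule mtrace_mfun_mono[OF X[OF AB]])
        fix x :: real assume "0 < x"
        from \<tau>(1)[OF this] \<tau>(2)[OF this]
        show "x * \<tau> x powr (-1) + 1 * h (\<tau> x) \<le> f x + \<epsilon> * 1" by (simp add: powr_minus_divide)
      qed
      also have "\<dots> = F A B + \<epsilon> * real l"
        using mtrace_mfun_add[OF X[OF AB], of f \<epsilon> "\<lambda>_. 1"] by (simp add: F tr1[OF AB])
      finally show ?thesis using Z by blast
    qed
    show ?thesis
    proof (rule field_le_epsilon)
      fix e :: real assume e: "0 < e"
      \<comment> \<open>The trace of the identity multiplies the error by \<open>l\<close>; adding 1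
        keeps the quotient positive for l = 0.\<close>
      define \<epsilon> where "\<epsilon> = e / (real l + 1)"
      have \<epsilon>: "0 < \<epsilon>" "\<epsilon> * real l \<le> e" using e by (auto simp: \<epsilon>_def field_simps)
      obtain Z1 where Z1: "pos_def l Z1" "Re (mtrace (Q B1 * mpow Z1 (-1))) + Re (mtrace (mfun h (T A1 Z1))) \<le> F A1 B1 + \<epsilon> * real l"
        using lower[OF A1 B1 \<epsilon>(1)] by blast
      obtain Z2 where Z2: "pos_def l Z2" "Re (mtrace (Q B2 * mpow Z2 (-1))) + Re (mtrace (mfun h (T A2 Z2))) \<le> F A2 B2 + \<epsilon> * real l"
        using lower[OF A2 B2 \<epsilon>(1)] by blast
      \<comment> \<open>The mixture of the two near-minimisers is the competitor for the mixed
        arguments, which is how an infimum of jointly convex functions stays convex.\<close>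
      define Z where "Z = mix t Z1 Z2"
      have Z: "pos_def l Z" unfolding Z_def by (rule pos_def_mix[OF Z1(1) Z2(1) t])
      have hT: "mfun (\<lambda>\<tau>. k (\<tau> powr (1 / (1 - r)))) (T A Z) = mfun h (T A Z)" if "pos_def n A" "pos_def l Z" for A Z
        by (rule mfun_cong[OF T[OF that]]) (rule hk)
      have "Re (mtrace (mfun h (T A Z))) \<le> t * Re (mtrace (mfun h (T A1 Z1))) + (1 - t) * Re (mtrace (mfun h (T A2 Z2)))"
        using sandwich_convex[OF kr\<Phi> sp\<Phi> k_conv k_mono A1 A2 Z1(1) Z2(1) r t]
        unfolding pr[symmetric] P_def[symmetric] T_def[symmetric] A_def[symmetric] Z_def[symmetric]
          hT[OF A Z] hT[OF A1 Z1(1)] hT[OF A2 Z2(1)] .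
      moreover have "Re (mtrace (Q B * mpow Z (-1))) \<le> t * Re (mtrace (Q B1 * mpow Z1 (-1))) + (1 - t) * Re (mtrace (Q B2 * mpow Z2 (-1)))"
        unfolding Q_def B_def Z_def by (rule kraus_square_inverse_convex[OF kr\<Psi> B1 B2 Z1(1) Z2(1) t])
      moreover have "t * (Re (mtrace (Q B1 * mpow Z1 (-1))) + Re (mtrace (mfun h (T A1 Z1)))) \<le> t * (F A1 B1 + \<epsilon> * real l)"
        using Z1(2) t by (intro mult_left_mono) auto
      moreover have "(1 - t) * (Re (mtrace (Q B2 * mpow Z2 (-1))) + Re (mtrace (mfun h (T A2 Z2)))) \<le> (1 - t) * (F A2 B2 + \<epsilon> * real l)"
        using Z2(2) t by (intro mult_left_mono) auto
      ultimately have "F A B \<le> t * F A1 B1 + (1 - t) * F A2 B2 + \<epsilon> * real l"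
        using upper[OF A B Z] by (simp add: algebra_simps)
      thus "F A B \<le> t * F A1 B1 + (1 - t) * F A2 B2 + e" using \<epsilon>(2) by simp
    qed
  qed
  thus ?thesis by (simp add: A_def B_def mix_def)
qed

end
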